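(* Let $\delta>0$ and let $(\alpha,S)$ be a phase-type job size distribution with mean $1$; write $y=y(\delta)=\alpha(\delta I-S)^{-1}s^*$. For integers $m\ge0$ put $$\lambda_m=\frac{\delta y(1-y^m)}{\delta y(1-y^m)+y^m(1-y)} .$$ Then for every integer $m>0$, the maximum queue length of the queue at the cavity of the push policy with probe rate $\delta$ and arrival rate $\lambda$ equals $m$ for $\lambda\in(\lambda_{m-1},\lambda_m]$. Further, fix $\lambda\in(0,1)$. For integers $m\ge1$ let $\delta_m>0$ be determined by $$\delta_m=\frac{y^{m-1}(1-y)}{1-y^m}\,\frac{\lambda}{1-\lambda}\quad\text{with } y=y(\delta_m),$$ and let $\delta_0=+\infty$. Then for every integer $m>0$ the maximum queue length of the queue at the cavity with arrival rate $\lambda$ and probe rate $\delta$ equals $m$ for $\delta\in[\delta_m,\delta_{m-1})$.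
   Context: Job sizes: $Z$ has a phase-type (PH) distribution $(\alpha,S)$, where $\alpha$ is a probability row vector of length $n_s$, $S$ is an invertible $n_s\times n_s$ subgenerator matrix, $s^*=-S\mathbf 1$ ($\mathbf 1$ the all-ones column), $P[Z>t]=\alpha e^{St}\mathbf 1$, and $E[Z]=\alpha(-S)^{-1}\mathbf 1=1$. Push policy chain: for an integer $m\ge 0$ and a real $\nu\ge 0$, consider the continuous-time Markov chain on the states $(0,e)$ and $(q,e,j)$ with $e\in\{m,m+1\}$, $1\le q\le e$, $1\le j\le n_s$ ($q$ = actual queue length, $e$ = estimated queue length, $j$ = service phase), with the following transitions. (i) Phase changes: $(q,e,j)\to(q,e,j')$ at rate $S_{jj'}$ for $j\ne j'$. (ii) Service completions: $(q,e,j)\to(q-1,e,j')$ at rate $s^*_j\alpha_{j'}$ if $q\ge2$; $(1,e,j)\to(0,e)$ at rate $s^*_j$. (iii) Probes: $(q,e,j)\to(\max(q,m),\max(q,m),j)$ at rate $\delta$; $(0,e)\to(m,m,j')$ at rate $\delta\alpha_{j'}$ if $m\ge1$ (if $m=0$: $(0,e)\to(0,0)$ at rate $\delta$). (iv) Job assignments: $(q,m,j)\to(q+1,m+1,j)$ at rate $\nu$ for $q\ge1$; $(0,m)\to(1,m+1,j')$ at rate $\nu\alpha_{j'}$. Let $\pi_q(m,\nu)$ be the stationary probability that the actual queue length is $q$. Queue at the cavity (arrival rate $\lambda\in[0,1)$, probe rate $\delta$): the stationary chain for the unique pair $(m,\nu)$, $m\in\{0,1,2,\dots\}$, $\nu\in[0,\infty)$,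 with $\pi_0(m,\nu)=1-\lambda$. Its maximum queue length is the largest $q$ with $\pi_q(m,\nu)>0$. *)

theory Defs
  imports "HOL-Analysis.Analysis"
begin

section \<open>Phase-type distributions\<close>

text \<open>The service phases form the finite index type \<open>'n\<close>, whose cardinality is the number of
  phases \<open>n\<^sub>s\<close>.\<close>

definition subgenerator :: "real^'n^'n \<Rightarrow> bool" where
  "subgenerator S \<longleftrightarrow>
     (\<forall>i j. i \<noteq> j \<longrightarrow> S $ i $ j \<ge> 0) \<and> (\<forall>i. (\<Sum>j\<in>UNIV. S $ i $ j) \<le> 0)"

definition phase_type :: "real^'n \<Rightarrow> real^'n^'n \<Rightarrow> bool" where
  "phase_type \<alpha> S \<longleftrightarrow>
     (\<forall>i. \<alpha> $ i \<ge> 0) \<and> (\<Sum>i\<in>UNIV. \<alpha> $ i) = 1 \<and> subgenerator S \<and> invertible S"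

definition exit_rate :: "real^'n^'n \<Rightarrow> real^'n" where
  "exit_rate S = - (S *v 1)"

definition ph_mean :: "real^'n \<Rightarrow> real^'n^'n \<Rightarrow> real" where
  "ph_mean \<alpha> S = (\<alpha> v* matrix_inv (- S)) \<bullet> 1"

text \<open>\<open>mat \<delta>\<close> is the scalar matrix \<open>\<delta> I\<close>.\<close>

definition y_val :: "real^'n \<Rightarrow> real^'n^'n \<Rightarrow> real \<Rightarrow> real" where
  "y_val \<alpha> S \<delta> = (\<alpha> v* matrix_inv (mat \<delta> - S)) \<bullet> exit_rate S"

section \<open>The push policy chain\<close>

text \<open>\<open>Idle e\<close> is the state \<open>(0, e)\<close> and \<open>Busy q e j\<close> is the state \<open>(q, e, j)\<close>.\<close>

datatype 'n state = Idle nat | Busy nat nat 'n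

fun queue_length :: "'n state \<Rightarrow> nat" where
  "queue_length (Idle e) = 0"
| "queue_length (Busy q e j) = q"

definition states :: "nat \<Rightarrow> 'n state set" where
  "states m = {Idle e | e. e \<in> {m, m + 1}}
            \<union> {Busy q e j | q e j. e \<in> {m, m + 1} \<and> 1 \<le> q \<and> q \<le> e}"

text \<open>The rates below are only meaningful between elements of \<open>states m\<close>.\<close>

fun phase_rate :: "real^'n^'n \<Rightarrow> 'n state \<Rightarrow> 'n state \<Rightarrow> real" where
  "phase_rate S (Busy q e j) (Busy q' e' j') =
     (if q' = q \<and> e' = e \<and> j' \<noteq> j then S $ j $ j' else 0)"
| "phase_rate S _ _ = 0"

fun service_rate :: "real^'n \<Rightarrow> real^'n^'n \<Rightarrow> 'n state \<Rightarrow> 'n state \<Rightarrow> real" where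
  "service_rate \<alpha> S (Busy q e j) (Busy q' e' j') =
     (if 2 \<le> q \<and> q' = q - 1 \<and> e' = e then exit_rate S $ j * \<alpha> $ j' else 0)"
| "service_rate \<alpha> S (Busy q e j) (Idle e') =
     (if q = 1 \<and> e' = e then exit_rate S $ j else 0)"
| "service_rate \<alpha> S _ _ = 0"

fun probe_rate :: "real^'n \<Rightarrow> real \<Rightarrow> nat \<Rightarrow> 'n state \<Rightarrow> 'n state \<Rightarrow> real" where
  "probe_rate \<alpha> \<delta> m (Busy q e j) (Busy q' e' j') =
     (if q' = max q m \<and> e' = max q m \<and> j' = j then \<delta> else 0)"
| "probe_rate \<alpha> \<delta> m (Idle e) (Busy q' e' j') =
     (if 1 \<le> m \<and> q' = m \<and> e' = m then \<delta> * \<alpha> $ j' else 0)"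
| "probe_rate \<alpha> \<delta> m (Idle e) (Idle e') = (if m = 0 \<and> e' = 0 then \<delta> else 0)"
| "probe_rate \<alpha> \<delta> m _ _ = 0"

fun assign_rate :: "real^'n \<Rightarrow> nat \<Rightarrow> real \<Rightarrow> 'n state \<Rightarrow> 'n state \<Rightarrow> real" where
  "assign_rate \<alpha> m \<nu> (Busy q e j) (Busy q' e' j') =
     (if 1 \<le> q \<and> e = m \<and> q' = q + 1 \<and> e' = m + 1 \<and> j' = j then \<nu> else 0)"
| "assign_rate \<alpha> m \<nu> (Idle e) (Busy q' e' j') =
     (if e = m \<and> q' = 1 \<and> e' = m + 1 then \<nu> * \<alpha> $ j' else 0)"
| "assign_rate \<alpha> m \<nu> _ _ = 0"

definition rate ::
  "real^'n \<Rightarrow> real^'n^'n \<Rightarrow> real \<Rightarrow> nat \<Rightarrow> real \<Rightarrow> 'n state \<Rightarrow> 'n state \<Rightarrow> real" where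
  "rate \<alpha> S \<delta> m \<nu> x x' =
     phase_rate S x x' + service_rate \<alpha> S x x' + probe_rate \<alpha> \<delta> m x x' + assign_rate \<alpha> m \<nu> x x'"

text \<open>A probe may leave the state unchanged, so \<open>rate\<close> can be positive on the diagonal. The
  generator, whose rows sum to zero, is unaffected by this.\<close>

definition generator ::
  "real^'n \<Rightarrow> real^'n^'n \<Rightarrow> real \<Rightarrow> nat \<Rightarrow> real \<Rightarrow> 'n state \<Rightarrow> 'n state \<Rightarrow> real" where
  "generator \<alpha> S \<delta> m \<nu> x x' =
     (if x = x' then - (\<Sum>z\<in>states m - {x}. rate \<alpha> S \<delta> m \<nu> x z) else rate \<alpha> S \<delta> m \<nu> x x')"

definition is_stationary ::
  "real^'n \<Rightarrow> real^'n^'n \<Rightarrow> real \<Rightarrow> nat \<Rightarrow> real \<Rightarrow> ('n state \<Rightarrow> real) \<Rightarrow> bool" where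
  "is_stationary \<alpha> S \<delta> m \<nu> p \<longleftrightarrow>
     (\<forall>x. p x \<ge> 0) \<and> (\<forall>x. x \<notin> states m \<longrightarrow> p x = 0) \<and> (\<Sum>x\<in>states m. p x) = 1 \<and>
     (\<forall>x'\<in>states m. (\<Sum>x\<in>states m. p x * generator \<alpha> S \<delta> m \<nu> x x') = 0)"

text \<open>For \<open>\<delta> > 0\<close> the chain has a single recurrent class, as \<open>Idle m\<close> can be reached from every
  state, so the stationary distribution is unique even if \<open>\<nu> = 0\<close> or some phases are never used.\<close>

definition stationary ::
  "real^'n \<Rightarrow> real^'n^'n \<Rightarrow> real \<Rightarrow> nat \<Rightarrow> real \<Rightarrow> 'n state \<Rightarrow> real" where
  "stationary \<alpha> S \<delta> m \<nu> = (THE p. is_stationary \<alpha> S \<delta> m \<nu> p)"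

definition queue_prob ::
  "real^'n \<Rightarrow> real^'n^'n \<Rightarrow> real \<Rightarrow> nat \<Rightarrow> real \<Rightarrow> nat \<Rightarrow> real" where
  "queue_prob \<alpha> S \<delta> m \<nu> q =
     (\<Sum>x\<in>{x \<in> states m. queue_length x = q}. stationary \<alpha> S \<delta> m \<nu> x)"

section \<open>The queue at the cavity\<close>

definition cavity_pair :: "real^'n \<Rightarrow> real^'n^'n \<Rightarrow> real \<Rightarrow> real \<Rightarrow> nat \<times> real" where
  "cavity_pair \<alpha> S \<delta> lam =
     (THE (m, \<nu>). \<nu> \<ge> 0 \<and> queue_prob \<alpha> S \<delta> m \<nu> 0 = 1 - lam)"

definition max_queue_length :: "real^'n \<Rightarrow> real^'n^'n \<Rightarrow> real \<Rightarrow> real \<Rightarrow> nat" where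
  "max_queue_length \<alpha> S \<delta> lam =
     (case cavity_pair \<alpha> S \<delta> lam of (m, \<nu>) \<Rightarrow> Max {q. queue_prob \<alpha> S \<delta> m \<nu> q > 0})"

section \<open>Thresholds\<close>

definition lambda_thr :: "real^'n \<Rightarrow> real^'n^'n \<Rightarrow> real \<Rightarrow> nat \<Rightarrow> real" where
  "lambda_thr \<alpha> S \<delta> m =
     (let y = y_val \<alpha> S \<delta> in \<delta> * y * (1 - y ^ m) / (\<delta> * y * (1 - y ^ m) + y ^ m * (1 - y)))"

definition is_delta_thr :: "real^'n \<Rightarrow> real^'n^'n \<Rightarrow> real \<Rightarrow> nat \<Rightarrow> real \<Rightarrow> bool" where
  "is_delta_thr \<alpha> S lam m d \<longleftrightarrow>
     d > 0 \<and> (let y = y_val \<alpha> S d in d = y ^ (m - 1) * (1 - y) / (1 - y ^ m) * (lam / (1 - lam)))"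

definition delta_thr :: "real^'n \<Rightarrow> real^'n^'n \<Rightarrow> real \<Rightarrow> nat \<Rightarrow> ereal" where
  "delta_thr \<alpha> S lam m = (if m = 0 then \<infinity> else ereal (THE d. is_delta_thr \<alpha> S lam m d))"

end

(* Write E_p for the expectation under a stationary distribution p and Q for the generator, so that
   E_p[Q g] = 0 for every function g on the states. Three kinds of g suffice. Functions of the phase
   alone show that the busy phases have total mass lam alpha (-S)^{-1}. The function y^{n-1} u_j,
   where u = (delta I - S)^{-1} s^* and n counts the jobs present plus the job that may still be
   assigned, gives
     lam = p(0,m) o_m + p(0,m+1) o_{m+1},   o_m = lambda_m / (1 - lambda_m).
   Functions supported on the states with e = m or q = m + 1 show that p(0,m) / pi_0 is an explicit
   function f(nu, L) of nu and L = lam / (1 - lam). For L >= o_m it is strictly decreasing in nu, from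
   a value >= 1 at nu = 0 to 0, and increasing in L. So for o_m <= L < o_{m+1} exactly one pair (m, nu)
   is possible, with nu = 0 iff L = o_m, and the longest queue is m if nu = 0 and m + 1 otherwise. The
   second part follows since o_m increases with delta. *)

theory Submission
  imports Defs
begin

text \<open>The stationary distribution is never solved for. A function g helps when Q g charges
  only masses that are already known, and the suitable g are assembled from solutions x of (s I - S)
  x = b. Since S may be reducible and exit rates may vanish in some phases, the signs of these
  solutions must come from invertibility of S alone: it rules out a set of phases that can neither
  be left nor end the service.

  \<open>stationary\<close> and \<open>cavity_pair\<close> are definite descriptions, so existence
  and uniqueness have to be proved. The balance equations are derived for an arbitrary stationary p;
  they force p(0,m) > 0, and uniqueness follows from this.

  The load is known only implicitly, because f depends on L as well as on nu: L = o_{m+1} - (o_{m+1}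
  - o_m) f(nu, L). For fixed nu the right side is nonincreasing in L, so the equation identifies L;
  for fixed L >= o_m it is strictly increasing in nu, so the equation identifies nu. This avoids an
  explicit formula for lam in terms of nu.\<close>

section \<open>Resolvents of an invertible subgenerator\<close>

lemma mat_diff_mult_vec:
  fixes S :: "real^'n^'n"
  shows "(mat s - S) *v x = s *\<^sub>R x - S *v x"
proof -
  have "mat s *v x = s *\<^sub>R x"
    by (simp add: vec_eq_iff matrix_vector_mult_def mat_def if_distrib [of "\<lambda>a. a * _"] cong: if_cong)
  then show ?thesis
    by (simp add: matrix_vector_mult_diff_rdistrib)
qed

lemma
  fixes A :: "real^'n^'n"
  assumes "invertible A"
  shows matrix_inv_right: "A ** matrix_inv A = mat 1"
    and matrix_inv_left: "matrix_inv A ** A = mat 1"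
  using someI_ex [of "\<lambda>B. A ** B = mat 1 \<and> B ** A = mat 1"] assms
  by (auto simp: invertible_def matrix_inv_def)

lemma inner_vec_nonneg:
  fixes a b :: "real^'n"
  assumes "\<And>i. 0 \<le> a $ i" "\<And>i. 0 \<le> b $ i"
  shows "0 \<le> a \<bullet> b"
  using assms by (simp add: inner_vec_def sum_nonneg)

locale phase_type_dist =
  fixes \<alpha> :: "real^'n" and S :: "real^'n^'n"
  assumes phase_type: "phase_type \<alpha> S"
    and ph_mean: "ph_mean \<alpha> S = 1"
begin

lemma alpha_nonneg: "0 \<le> \<alpha> $ i"
  and alpha_sum: "(\<Sum>i\<in>UNIV. \<alpha> $ i) = 1"
  and off_diag_nonneg: "i \<noteq> j \<Longrightarrow> 0 \<le> S $ i $ j"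
  and invertible_S: "invertible S"
  using phase_type by (auto simp: phase_type_def subgenerator_def)

abbreviation exit :: "real^'n" where "exit \<equiv> exit_rate S"

lemma exit_nth: "exit $ i = - (\<Sum>j\<in>UNIV. S $ i $ j)"
  by (simp add: exit_rate_def matrix_vector_mult_def)

lemma exit_nonneg: "0 \<le> exit $ i"
  using phase_type by (simp add: exit_nth phase_type_def subgenerator_def)

lemma alpha_inner_one: "\<alpha> \<bullet> 1 = 1"
  using alpha_sum by (simp add: inner_vec_def)

lemma alpha_inner_nonneg: "(\<And>i. 0 \<le> b $ i) \<Longrightarrow> 0 \<le> \<alpha> \<bullet> b"
  by (simp add: inner_vec_nonneg alpha_nonneg)

lemma alpha_inner_pos:
  assumes "\<And>i. 0 < b $ i"
  shows "0 < \<alpha> \<bullet> b"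
proof -
  obtain i where "\<alpha> $ i \<noteq> 0"
    using alpha_sum by (metis sum.neutral zero_neq_one)
  then have "0 < \<alpha> $ i * b $ i"
    using alpha_nonneg [of i] assms by (simp add: less_le)
  then show ?thesis
    unfolding inner_vec_def inner_real_def
    by (intro sum_pos2 [of UNIV i]) (auto simp: alpha_nonneg assms less_imp_le)
qed

text \<open>Row i of S sums to \<open>- exit $ i\<close>. With c = \<open>x $ i\<close> the diagonal
  entry drops out, and only entries of known sign remain.\<close>

lemma S_mult_shift:
  "(S *v x) $ i = (\<Sum>j\<in>UNIV. S $ i $ j * (x $ j - c)) - c * exit $ i"
  by (simp add: matrix_vector_mult_def exit_nth right_diff_distrib sum_subtractf sum_distrib_left
      mult.commute [of _ c])

text \<open>A solution of S x = -1 is the vector of mean remaining service times, which would be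
  infinite on a set that is never left. Formally, at a minimum of x over Z the entry of S x would be
  nonnegative instead of -1.\<close>

lemma no_closed_class:
  assumes "Z \<noteq> {}" and exit0: "\<And>i. i \<in> Z \<Longrightarrow> exit $ i = 0"
    and closed: "\<And>i j. i \<in> Z \<Longrightarrow> j \<notin> Z \<Longrightarrow> S $ i $ j = 0"
  shows False
proof -
  define x where "x = matrix_inv S *v (-1)"
  have x: "S *v x = - 1"
    using invertible_S by (simp add: x_def matrix_vector_mul_assoc matrix_inv_right)
  have "finite Z" by simp
  then obtain i where i: "i \<in> Z" "\<And>j. j \<in> Z \<Longrightarrow> x $ i \<le> x $ j"
    using \<open>Z \<noteq> {}\<close> by (metis arg_min_if_finite(1) arg_min_least)
  have "0 \<le> S $ i $ j * (x $ j - x $ i)" for j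
    using i closed [of i j] off_diag_nonneg [of i j]
    by (cases "j \<in> Z"; cases "i = j") auto
  then have "0 \<le> (S *v x) $ i"
    using exit0 [OF i(1)] by (simp add: S_mult_shift [of x i "x $ i"] sum_nonneg)
  then show False
    by (simp add: x)
qed

text \<open>At a negative minimum c all terms of the shifted row are nonnegative, while their sum is
  at most s c <= 0. So they vanish, and the minimal phases form a closed class without exit.\<close>

lemma minimum_principle:
  assumes "0 \<le> s" and super: "\<And>i. (S *v x) $ i \<le> s * x $ i"
  shows "0 \<le> x $ i"
proof (rule ccontr)
  assume neg: "\<not> 0 \<le> x $ i"
  obtain k where k: "\<And>j. x $ k \<le> x $ j"
    by (metis UNIV_I arg_min_least empty_iff finite_class.finite_UNIV)
  define c where "c = x $ k"
  have c: "c \<le> x $ j" for j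
    using k by (simp add: c_def)
  have "c < 0"
    using neg c [of i] by linarith
  define Z where "Z = {j. x $ j = c}"
  have *: "exit $ j = 0 \<and> (\<forall>l. l \<notin> Z \<longrightarrow> S $ j $ l = 0)" if "j \<in> Z" for j
  proof -
    have xj: "x $ j = c"
      using that by (simp add: Z_def)
    have nn: "0 \<le> S $ j $ l * (x $ l - c)" for l
      using c [of l] off_diag_nonneg [of j l] xj by (cases "j = l") auto
    have "(\<Sum>l\<in>UNIV. S $ j $ l * (x $ l - c)) + (- c) * exit $ j \<le> s * c"
      using super [of j] S_mult_shift [of x j c] xj by simp
    moreover have "s * c \<le> 0"
      using \<open>0 \<le> s\<close> \<open>c < 0\<close> by (simp add: mult_nonneg_nonpos)
    moreover have "0 \<le> (- c) * exit $ j"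
      using \<open>c < 0\<close> exit_nonneg by (intro mult_nonneg_nonneg) auto
    moreover have "0 \<le> (\<Sum>l\<in>UNIV. S $ j $ l * (x $ l - c))"
      by (simp add: nn sum_nonneg)
    ultimately have "(- c) * exit $ j = 0" and "(\<Sum>l\<in>UNIV. S $ j $ l * (x $ l - c)) = 0"
      by linarith+
    then show ?thesis
      using \<open>c < 0\<close> nn by (auto simp: sum_nonneg_eq_0_iff Z_def)
  qed
  have "k \<in> Z"
    by (simp add: Z_def c_def)
  with * show False
    using no_closed_class [of Z] by blast
qed

section \<open>Resolvent vectors: signs, resolvent identity, dependence on s\<close>

lemma invertible_shift:
  assumes "0 \<le> s"
  shows "invertible (mat s - S)"
proof -
  have "x = 0" if "(mat s - S) *v x = 0" for x
  proof -
    have eq: "S *v x = s *\<^sub>R x"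
      using that by (simp add: mat_diff_mult_vec)
    have "0 \<le> x $ i" for i
      using assms eq by (intro minimum_principle [of s]) auto
    moreover have "0 \<le> (- x) $ i" for i
      using assms eq
      by (intro minimum_principle [of s]) (auto simp: matrix_vector_mult_def sum_negf vec_eq_iff)
    ultimately show "x = 0"
      by (simp add: vec_eq_iff order_antisym)
  qed
  then show ?thesis
    by (metis invertible_left_inverse matrix_left_invertible_ker)
qed

text \<open>Entry j is the expected integral of b over the phases visited until the end of a service
  now in phase j, discounted at rate s. Thus b = exit gives the Laplace transform of the remaining
  service time, and b = 1 with s = 0 gives its mean.\<close>

definition resolvent :: "real \<Rightarrow> real^'n \<Rightarrow> real^'n" where
  "resolvent s b = matrix_inv (mat s - S) *v b"

lemma S_mult_resolvent:
  assumes "0 \<le> s"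
  shows "S *v resolvent s b = s *\<^sub>R resolvent s b - b"
proof -
  have "(mat s - S) *v resolvent s b = b"
    using invertible_shift [OF assms]
    by (simp add: resolvent_def matrix_vector_mul_assoc matrix_inv_right)
  then have "s *\<^sub>R resolvent s b - S *v resolvent s b = b"
    by (simp only: mat_diff_mult_vec)
  then show ?thesis
    by (simp add: algebra_simps)
qed

lemma resolvent_unique:
  assumes "0 \<le> s" "S *v x = s *\<^sub>R x - b"
  shows "resolvent s b = x"
proof -
  have "b = (mat s - S) *v x"
    using assms by (simp add: mat_diff_mult_vec)
  then show ?thesis
    using invertible_shift [OF assms(1)]
    by (simp add: resolvent_def matrix_vector_mul_assoc matrix_inv_left)
qed

lemma resolvent_nonneg:
  assumes "0 \<le> s" "\<And>i. 0 \<le> b $ i"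
  shows "0 \<le> resolvent s b $ i"
  using assms by (intro minimum_principle [of s]) (auto simp: S_mult_resolvent)

text \<open>The diagonal entry is the only one in its row that may be negative, and it is multiplied
  by \<open>x $ i\<close> = 0.\<close>

lemma S_mult_nonneg_zero:
  assumes "\<And>j. 0 \<le> x $ j" "x $ i = 0"
  shows "0 \<le> (S *v x) $ i"
  unfolding matrix_vector_mult_def
  using assms off_diag_nonneg by (auto intro!: sum_nonneg) (metis mult_nonneg_nonneg mult_zero_right)

lemma resolvent_pos:
  assumes "0 \<le> s" "\<And>i. 0 < b $ i"
  shows "0 < resolvent s b $ i"
proof -
  have nn: "0 \<le> resolvent s b $ j" for j
    using assms by (simp add: resolvent_nonneg less_imp_le)
  have False if "resolvent s b $ i = 0"
    using S_mult_nonneg_zero [OF nn that] assms(2) [of i] that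
    by (simp add: S_mult_resolvent [OF assms(1)])
  then show ?thesis
    using nn [of i] by force
qed

text \<open>\<open>resolvent_pos\<close> does not apply, because some exit rates may be zero. A zero
  of u forces a zero exit rate and zeros in all phases one jump away, so the zeros form a closed
  class.\<close>

lemma resolvent_exit_pos:
  assumes "0 \<le> s"
  shows "0 < resolvent s exit $ i"
proof -
  define u where "u = resolvent s exit"
  define Z where "Z = {j. u $ j = 0}"
  have nn: "0 \<le> u $ j" for j
    using assms by (simp add: resolvent_nonneg u_def exit_nonneg)
  have "exit $ j = 0 \<and> (\<forall>l. l \<notin> Z \<longrightarrow> S $ j $ l = 0)" if "j \<in> Z" for j
  proof -
    have uj: "u $ j = 0"
      using that by (simp add: Z_def)
    have "(S *v u) $ j = - exit $ j"
      using S_mult_resolvent [OF assms, of exit] uj by (simp add: u_def)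
    then have eq: "(\<Sum>l\<in>UNIV. S $ j $ l * u $ l) = 0" and e: "exit $ j = 0"
      using S_mult_nonneg_zero [OF nn uj] exit_nonneg [of j]
      by (simp_all add: matrix_vector_mult_def)
    have "0 \<le> S $ j $ l * u $ l" for l
      using nn [of l] off_diag_nonneg [of j l] uj by (cases "j = l") auto
    with eq e show ?thesis
      by (auto simp: sum_nonneg_eq_0_iff Z_def)
  qed
  then have "Z = {}"
    using no_closed_class [of Z] by blast
  then show ?thesis
    using nn [of i] by (force simp: Z_def u_def less_le)
qed

lemma resolvent_identity:
  assumes "0 \<le> s" "0 \<le> t"
  shows "resolvent s b - resolvent t b = (t - s) *\<^sub>R resolvent s (resolvent t b)"
proof -
  have "resolvent s b = resolvent t b + (t - s) *\<^sub>R resolvent s (resolvent t b)"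
    using assms
    by (intro resolvent_unique)
      (simp_all add: matrix_vector_right_distrib matrix_vector_mult_scaleR S_mult_resolvent
        algebra_simps)
  then show ?thesis
    by simp
qed

lemma resolvent_diff: "resolvent s (b - c) = resolvent s b - resolvent s c"
  by (simp add: resolvent_def matrix_vector_mult_diff_distrib)

lemma resolvent_antimono:
  assumes "0 \<le> s" "s \<le> t" "\<And>i. 0 \<le> b $ i"
  shows "resolvent t b $ i \<le> resolvent s b $ i"
proof -
  have "0 \<le> ((t - s) *\<^sub>R resolvent s (resolvent t b)) $ i"
    using assms by (simp add: resolvent_nonneg)
  then show ?thesis
    using resolvent_identity [of s t b] assms by (metis diff_ge_0_iff_ge order_trans vector_minus_component)
qed

lemma resolvent_0_exit: "resolvent 0 exit = 1"
  by (rule resolvent_unique) (auto simp: exit_rate_def)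

lemma alpha_resolvent_0_one: "\<alpha> \<bullet> resolvent 0 1 = 1"
proof -
  have "mat 0 - S = - S"
    by (simp add: vec_eq_iff mat_def)
  then show ?thesis
    using ph_mean by (simp add: ph_mean_def resolvent_def dot_lmul_matrix)
qed

lemma alpha_resolvent_antimono:
  assumes "0 \<le> s" "s \<le> t" "\<And>i. 0 \<le> b $ i"
  shows "\<alpha> \<bullet> resolvent t b \<le> \<alpha> \<bullet> resolvent s b"
proof -
  have "0 \<le> \<alpha> \<bullet> (resolvent s b - resolvent t b)"
    using assms by (intro alpha_inner_nonneg) (simp add: resolvent_antimono)
  then show ?thesis
    by (simp add: inner_diff_right)
qed

text \<open>The constant comes from the resolvent identity, with both resolvents in the product
  bounded by those at 0.\<close>

lemma alpha_resolvent_lipschitz: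
  assumes "0 \<le> s" "s \<le> t" "\<And>i. 0 \<le> b $ i"
  shows "\<alpha> \<bullet> resolvent s b - \<alpha> \<bullet> resolvent t b \<le> (t - s) * (\<alpha> \<bullet> resolvent 0 (resolvent 0 b))"
proof -
  have "0 \<le> resolvent 0 (resolvent 0 b) $ i - resolvent s (resolvent t b) $ i" for i
  proof -
    have "resolvent s (resolvent t b) $ i \<le> resolvent 0 (resolvent t b) $ i"
      using assms by (intro resolvent_antimono) (auto intro: resolvent_nonneg)
    moreover have "0 \<le> resolvent 0 (resolvent 0 b - resolvent t b) $ i"
      using assms by (intro resolvent_nonneg) (auto intro: resolvent_antimono)
    ultimately show ?thesis
      by (simp add: resolvent_diff)
  qed
  then have "\<alpha> \<bullet> resolvent s (resolvent t b) \<le> \<alpha> \<bullet> resolvent 0 (resolvent 0 b)"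
    using alpha_inner_nonneg [of "resolvent 0 (resolvent 0 b) - resolvent s (resolvent t b)"]
    by (simp add: inner_diff_right)
  moreover have "\<alpha> \<bullet> resolvent s b - \<alpha> \<bullet> resolvent t b = (t - s) * (\<alpha> \<bullet> resolvent s (resolvent t b))"
    using arg_cong [OF resolvent_identity [of s t b], of "inner \<alpha>"] assms
    by (simp add: inner_diff_right)
  ultimately show ?thesis
    using assms by (simp add: mult_left_mono)
qed

lemma continuous_alpha_resolvent:
  assumes "\<And>i. 0 \<le> b $ i"
  shows "continuous_on {0..} (\<lambda>s. \<alpha> \<bullet> resolvent s b)"
proof -
  let ?C = "\<alpha> \<bullet> resolvent 0 (resolvent 0 b)"
  have C: "0 \<le> ?C"
    using assms by (intro alpha_inner_nonneg resolvent_nonneg) auto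
  have *: "\<bar>\<alpha> \<bullet> resolvent s b - \<alpha> \<bullet> resolvent t b\<bar> \<le> ?C * \<bar>s - t\<bar>" if "0 \<le> s" "s \<le> t" for s t
    using alpha_resolvent_antimono [OF that assms] alpha_resolvent_lipschitz [OF that assms] that
    by (simp add: mult.commute)
  have "?C-lipschitz_on {0..} (\<lambda>s. \<alpha> \<bullet> resolvent s b)"
  proof (rule lipschitz_onI)
    fix s t :: real
    assume "s \<in> {0..}" "t \<in> {0..}"
    then show "dist (\<alpha> \<bullet> resolvent s b) (\<alpha> \<bullet> resolvent t b) \<le> ?C * dist s t"
      unfolding dist_real_def
      using * [of s t] * [of t s] by (cases "s \<le> t") (simp_all add: abs_minus_commute)
  qed (rule C)
  then show ?thesis
    by (rule lipschitz_on_continuous_on)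
qed

section \<open>The Laplace transform y of the job size\<close>

abbreviation y :: "real \<Rightarrow> real" where "y \<equiv> y_val \<alpha> S"

lemma y_eq: "y s = \<alpha> \<bullet> resolvent s exit"
  by (simp add: y_val_def resolvent_def dot_lmul_matrix)

lemma y_0: "y 0 = 1"
  by (simp add: y_eq resolvent_0_exit alpha_inner_one)

lemma y_pos: "0 \<le> s \<Longrightarrow> 0 < y s"
  unfolding y_eq by (intro alpha_inner_pos resolvent_exit_pos)

lemma y_strict_antimono:
  assumes "0 \<le> s" "s < t"
  shows "y t < y s"
proof -
  have "y s - y t = (t - s) * (\<alpha> \<bullet> resolvent s (resolvent t exit))"
    using arg_cong [OF resolvent_identity [of s t exit], of "inner \<alpha>"] assms
    by (simp add: y_eq inner_diff_right)
  moreover have "0 < \<alpha> \<bullet> resolvent s (resolvent t exit)"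
    using assms by (intro alpha_inner_pos resolvent_pos resolvent_exit_pos) auto
  ultimately show ?thesis
    using assms by (metis diff_gt_0_iff_gt mult_pos_pos)
qed

lemma y_antimono: "0 \<le> s \<Longrightarrow> s \<le> t \<Longrightarrow> y t \<le> y s"
  using y_strict_antimono [of s t] by (cases "s = t") auto

lemma y_less_1: "0 < s \<Longrightarrow> y s < 1"
  using y_strict_antimono [of 0 s] by (simp add: y_0)

lemma continuous_y: "continuous_on {0..} y"
  unfolding y_eq by (intro continuous_alpha_resolvent exit_nonneg)

end

section \<open>Null vectors of finite generators\<close>

text \<open>Induction on the number of states: censoring the chain on the complement of one state \<open>a\<close>.\<close>

lemma generator_null_vector:
  fixes Q :: "'a \<Rightarrow> 'a \<Rightarrow> real"
  assumes "finite X" "X \<noteq> {}"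
    and "\<And>x z. x \<in> X \<Longrightarrow> z \<in> X \<Longrightarrow> x \<noteq> z \<Longrightarrow> 0 \<le> Q x z"
    and "\<And>x. x \<in> X \<Longrightarrow> (\<Sum>z\<in>X. Q x z) = 0"
  shows "\<exists>p. (\<forall>x\<in>X. 0 \<le> p x) \<and> (\<exists>x\<in>X. p x \<noteq> 0) \<and> (\<forall>z\<in>X. (\<Sum>x\<in>X. p x * Q x z) = 0)"
  using assms
proof (induction X arbitrary: Q rule: finite_induct)
  case empty
  then show ?case by simp
next
  case (insert a X)
  have row_a: "(\<Sum>z\<in>X. Q a z) = - Q a a"
    using insert.prems(3) [of a] insert.hyps by simp
  have nn_a: "0 \<le> Q a z" if "z \<in> X" for z
    using insert.prems(2) [of a z] insert.hyps that by auto
  show ?case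
  \<comment> \<open>If a is absorbing, the point mass at a is a null vector. Otherwise a is left at
    a positive rate c and can be censored.\<close>
  proof (cases "Q a a = 0")
    case True
    then have "\<forall>z\<in>X. Q a z = 0"
      using row_a nn_a sum_nonneg_eq_0_iff [OF insert.hyps(1), of "Q a"] by simp
    then have "(\<Sum>x\<in>insert a X. (if x = a then 1 else 0) * Q x z) = 0" if "z \<in> insert a X" for z
      using that True insert.hyps
      by (auto intro!: sum.neutral)
    then show ?thesis
      by (intro exI [of _ "\<lambda>x. if x = a then 1 else 0"]) auto
  next
    case False
    define c where "c = - Q a a"
    have "0 \<le> c"
      using row_a nn_a by (metis c_def sum_nonneg)
    with False have "0 < c"
      by (simp add: c_def)
    have "X \<noteq> {}"
      using False row_a by auto
    \<comment> \<open>A jump from x to a is redirected to the state entered after a, which is z with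
      probability Q a z / c.\<close>
    define Q' where "Q' x z = Q x z + Q x a * Q a z / c" for x z
    have "(\<Sum>z\<in>X. Q' x z) = 0" if "x \<in> X" for x
    proof -
      have "(\<Sum>z\<in>X. Q' x z) = (\<Sum>z\<in>X. Q x z) + Q x a * (\<Sum>z\<in>X. Q a z) / c"
        by (simp add: Q'_def sum.distrib sum_distrib_left sum_divide_distrib)
      also have "\<dots> = (\<Sum>z\<in>insert a X. Q x z)"
        using \<open>0 < c\<close> insert.hyps by (simp add: row_a flip: c_def)
      finally show ?thesis
        using insert.prems(3) that by simp
    qed
    moreover have "0 \<le> Q' x z" if "x \<in> X" "z \<in> X" "x \<noteq> z" for x z
      unfolding Q'_def
      using that insert.prems(2) [of x z] insert.prems(2) [of x a] insert.hyps nn_a \<open>0 < c\<close>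
      by (intro add_nonneg_nonneg divide_nonneg_pos mult_nonneg_nonneg) auto
    ultimately obtain p where p: "\<forall>x\<in>X. 0 \<le> p x" "\<exists>x\<in>X. p x \<noteq> 0"
      "\<forall>z\<in>X. (\<Sum>x\<in>X. p x * Q' x z) = 0"
      using insert.IH [of Q'] \<open>X \<noteq> {}\<close> by blast
    \<comment> \<open>The balance equation at a forces this mass.\<close>
    define b where "b = (\<Sum>x\<in>X. p x * Q x a) / c"
    define p' where "p' x = (if x = a then b else p x)" for x
    have "p' x = p x" if "x \<in> X" for x
      using that insert.hyps by (auto simp: p'_def)
    then have sum_p': "(\<Sum>x\<in>insert a X. p' x * Q x z) = b * Q a z + (\<Sum>x\<in>X. p x * Q x z)" for z
      using insert.hyps by (simp add: p'_def cong: sum.cong)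
    have "(\<Sum>x\<in>insert a X. p' x * Q x z) = 0" if "z \<in> insert a X" for z
    proof (cases "z = a")
      case True
      then show ?thesis
        using \<open>0 < c\<close> by (simp add: sum_p' b_def c_def)
    next
      case False
      have "b * Q a z + (\<Sum>x\<in>X. p x * Q x z) = (\<Sum>x\<in>X. p x * Q' x z)"
        by (simp add: Q'_def b_def distrib_left sum.distrib sum_distrib_right sum_divide_distrib
            mult.assoc)
      then show ?thesis
        using False that p(3) by (simp add: sum_p')
    qed
    moreover have "0 \<le> b"
      unfolding b_def
      using \<open>0 < c\<close> p(1) insert.prems(2) [of _ a] insert.hyps
      by (intro divide_nonneg_pos sum_nonneg mult_nonneg_nonneg) auto
    ultimately show ?thesis
      using p(1,2) \<open>\<And>x. x \<in> X \<Longrightarrow> p' x = p x\<close>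
      by (intro exI [of _ p'] conjI) (auto simp: p'_def)
  qed
qed

text \<open>The triangle inequality makes every entry of the row vector |p| Q nonnegative. The
  entries add up to 0 because the rows of Q do, so each is 0.\<close>

lemma generator_null_vector_abs:
  fixes Q :: "'a \<Rightarrow> 'a \<Rightarrow> real"
  assumes "finite X"
    and off_diag: "\<And>x z. x \<in> X \<Longrightarrow> z \<in> X \<Longrightarrow> x \<noteq> z \<Longrightarrow> 0 \<le> Q x z"
    and rows: "\<And>x. x \<in> X \<Longrightarrow> (\<Sum>z\<in>X. Q x z) = 0"
    and null: "\<And>z. z \<in> X \<Longrightarrow> (\<Sum>x\<in>X. p x * Q x z) = 0"
    and "z \<in> X"
  shows "(\<Sum>x\<in>X. \<bar>p x\<bar> * Q x z) = 0"
proof -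
  have nonneg: "0 \<le> (\<Sum>x\<in>X. \<bar>p x\<bar> * Q x z)" if "z \<in> X" for z
  proof -
    have "Q z z \<le> 0"
      using rows [OF that] off_diag [OF that] that \<open>finite X\<close>
      by (simp add: sum.remove [of X z])
        (metis (no_types, lifting) DiffD1 DiffD2 add_nonneg_eq_0_iff add_nonneg_nonneg insertI1
          linorder_le_cases order_antisym sum_nonneg)
    have "- (p z * Q z z) = (\<Sum>x\<in>X - {z}. p x * Q x z)"
      using null [OF that] that \<open>finite X\<close> by (simp add: sum.remove [of X z])
    then have "\<bar>p z * Q z z\<bar> = \<bar>\<Sum>x\<in>X - {z}. p x * Q x z\<bar>"
      by (metis abs_minus_cancel)
    also have "\<dots> \<le> (\<Sum>x\<in>X - {z}. \<bar>p x * Q x z\<bar>)"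
      by (rule sum_abs)
    also have "\<dots> = (\<Sum>x\<in>X - {z}. \<bar>p x\<bar> * Q x z)"
      using off_diag that by (intro sum.cong) (auto simp: abs_mult)
    finally show ?thesis
      using that \<open>finite X\<close> \<open>Q z z \<le> 0\<close> by (simp add: sum.remove [of X z] abs_mult)
  qed
  have "(\<Sum>z\<in>X. \<Sum>x\<in>X. \<bar>p x\<bar> * Q x z) = 0"
    by (subst sum.swap) (simp add: rows flip: sum_distrib_left)
  then show ?thesis
    using nonneg \<open>z \<in> X\<close> \<open>finite X\<close> by (simp add: sum_nonneg_eq_0_iff)
qed

section \<open>Drift of a test function\<close>

lemma finite_states: "finite (states m :: 'n::finite state set)"
  and sum_states: "(\<Sum>x\<in>states m. F x) =
    (\<Sum>e\<in>{m, m + 1}. F (Idle e) + (\<Sum>q\<in>{1..e}. \<Sum>j\<in>UNIV. F (Busy q e j)))"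
    for F :: "'n::finite state \<Rightarrow> real"
proof -
  let ?I = "Idle ` {m, m + 1} :: 'n::finite state set"
  let ?T = "SIGMA e:{m, m + 1}. {1..e} \<times> (UNIV :: 'n::finite set)"
  let ?f = "\<lambda>(e, q, j). Busy q e j"
  have states: "(states m :: 'n::finite state set) = ?I \<union> ?f ` ?T"
    by (auto simp: states_def image_iff)
  then show "finite (states m :: 'n::finite state set)"
    by simp
  have "(\<Sum>x\<in>states m. F x) = (\<Sum>x\<in>?I. F x) + (\<Sum>x\<in>?f ` ?T. F x)"
    unfolding states by (rule sum.union_disjoint) auto
  also have "(\<Sum>x\<in>?I. F x) = (\<Sum>e\<in>{m, m + 1}. F (Idle e))"
    by (subst sum.reindex) (auto simp: inj_on_def)
  also have "(\<Sum>x\<in>?f ` ?T. F x) = (\<Sum>(e, q, j)\<in>?T. F (Busy q e j))"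
    by (subst sum.reindex) (auto simp: inj_on_def intro!: sum.cong)
  also have "\<dots> = (\<Sum>e\<in>{m, m + 1}. \<Sum>q\<in>{1..e}. \<Sum>j\<in>UNIV. F (Busy q e j))"
    by (subst sum.Sigma [symmetric]) (auto simp: sum.cartesian_product)
  finally show "(\<Sum>x\<in>states m. F x) =
    (\<Sum>e\<in>{m, m + 1}. F (Idle e) + (\<Sum>q\<in>{1..e}. \<Sum>j\<in>UNIV. F (Busy q e j)))"
    by (simp add: sum.distrib)
qed

lemma Busy_in_states [simp]: "Busy q e j \<in> states m \<longleftrightarrow> (e = m \<or> e = m + 1) \<and> 1 \<le> q \<and> q \<le> e"
  and Idle_in_states [simp]: "Idle e \<in> states m \<longleftrightarrow> e = m \<or> e = m + 1"
  by (auto simp: states_def)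

text \<open>From a given state, each kind of transition leads to one idle state or to the states of
  one pair (q, e). This lemma and \<open>sum_states_Idle\<close> reduce the sum over all successors
  to that target.\<close>

lemma sum_states_Busy:
  fixes f :: "'n::finite state \<Rightarrow> real"
  assumes "e = m \<or> e = m + 1" "1 \<le> q" "q \<le> e"
    and "\<And>x. x \<notin> range (Busy q e) \<Longrightarrow> r x = 0"
  shows "(\<Sum>x\<in>states m. r x * f x) = (\<Sum>j\<in>UNIV. r (Busy q e j) * f (Busy q e j))"
proof -
  have "(\<Sum>x\<in>states m. r x * f x) = (\<Sum>x\<in>range (Busy q e). r x * f x)"
    using assms by (intro sum.mono_neutral_right finite_states) auto
  also have "\<dots> = (\<Sum>j\<in>UNIV. r (Busy q e j) * f (Busy q e j))"
    by (subst sum.reindex) (auto simp: inj_on_def)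
  finally show ?thesis .
qed

lemma sum_states_Idle:
  fixes f :: "'n::finite state \<Rightarrow> real"
  assumes "e = m \<or> e = m + 1" and "\<And>x. x \<noteq> Idle e \<Longrightarrow> r x = 0"
  shows "(\<Sum>x\<in>states m. r x * f x) = r (Idle e) * f (Idle e)"
proof -
  have "(\<Sum>x\<in>states m. r x * f x) = (\<Sum>x\<in>{Idle e}. r x * f x)"
    using assms by (intro sum.mono_neutral_right finite_states) auto
  then show ?thesis by simp
qed

locale push_policy = phase_type_dist \<alpha> S
  for \<alpha> :: "real^'n" and S :: "real^'n^'n" +
  fixes \<delta> :: real
  assumes delta_pos: "0 < \<delta>"
begin

text \<open>This is the generator applied to g. Written with differences of g, it lets probes that
  leave the state unchanged contribute nothing, so \<open>rate\<close> can replace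
  \<open>generator\<close>.\<close>

definition drift :: "nat \<Rightarrow> real \<Rightarrow> ('n state \<Rightarrow> real) \<Rightarrow> 'n state \<Rightarrow> real" where
  "drift m \<nu> g x = (\<Sum>z\<in>states m. rate \<alpha> S \<delta> m \<nu> x z * (g z - g x))"

lemma sum_generator_mult:
  assumes "x \<in> states m"
  shows "(\<Sum>z\<in>states m. generator \<alpha> S \<delta> m \<nu> x z * g z) = drift m \<nu> g x"
proof -
  have "(\<Sum>z\<in>states m. generator \<alpha> S \<delta> m \<nu> x z * g z)
      = (\<Sum>z\<in>states m - {x}. rate \<alpha> S \<delta> m \<nu> x z * g z)
        - (\<Sum>z\<in>states m - {x}. rate \<alpha> S \<delta> m \<nu> x z) * g x"
    unfolding sum.remove [OF finite_states assms]
    by (simp add: generator_def) (rule sum.cong; auto)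
  also have "\<dots> = drift m \<nu> g x"
    using assms by (simp add: drift_def sum.remove [OF finite_states, of x] right_diff_distrib
        sum_subtractf sum_distrib_right)
  finally show ?thesis .
qed

lemma generator_row_sum:
  "x \<in> states m \<Longrightarrow> (\<Sum>z\<in>states m. generator \<alpha> S \<delta> m \<nu> x z) = 0"
  using sum_generator_mult [of x m \<nu> "\<lambda>_. 1"] by (simp add: drift_def)

lemma generator_off_diag_nonneg:
  assumes "0 \<le> \<nu>" "x \<noteq> z"
  shows "0 \<le> generator \<alpha> S \<delta> m \<nu> x z"
proof -
  have "0 \<le> phase_rate S x z"
    by (cases x; cases z) (auto simp: off_diag_nonneg)
  moreover have "0 \<le> service_rate \<alpha> S x z"
    by (cases x; cases z) (auto simp: exit_nonneg alpha_nonneg)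
  moreover have "0 \<le> probe_rate \<alpha> \<delta> m x z"
    using delta_pos by (cases x; cases z) (auto simp: alpha_nonneg)
  moreover have "0 \<le> assign_rate \<alpha> m \<nu> x z"
    using assms by (cases x; cases z) (auto simp: alpha_nonneg)
  ultimately show ?thesis
    using assms by (simp add: generator_def rate_def)
qed

text \<open>Collecting the busy values in a vector for each (q, e) lets phase changes act as
  \<open>S *v\<close>; an idle value plays the role of the \<alpha>-average of a vector at q =
  0.\<close>

definition test :: "(nat \<Rightarrow> real) \<Rightarrow> (nat \<Rightarrow> nat \<Rightarrow> real^'n) \<Rightarrow> 'n state \<Rightarrow> real" where
  "test a b x = (case x of Idle e \<Rightarrow> a e | Busy q e j \<Rightarrow> b q e $ j)"

lemma test_simps [simp]: "test a b (Idle e) = a e" "test a b (Busy q e j) = b q e $ j"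
  by (simp_all add: test_def)

lemma sum_alpha_diff: "(\<Sum>j\<in>UNIV. \<alpha> $ j * (v $ j - c)) = \<alpha> \<bullet> v - c"
  by (simp add: inner_vec_def right_diff_distrib sum_subtractf alpha_sum flip: sum_distrib_right)

lemma drift_Idle:
  assumes e: "e = m \<or> e = m + 1"
  shows "drift m \<nu> (test a b) (Idle e) =
    \<delta> * ((if m = 0 then a 0 else \<alpha> \<bullet> b m m) - a e)
    + (if e = m then \<nu> * (\<alpha> \<bullet> b 1 (m + 1) - a e) else 0)"
proof -
  let ?f = "\<lambda>z. test a b z - a e"
  have "(\<Sum>z\<in>states m. probe_rate \<alpha> \<delta> m (Idle e) z * ?f z) =
    \<delta> * ((if m = 0 then a 0 else \<alpha> \<bullet> b m m) - a e)"
  proof (cases "m = 0")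
    case True
    have "probe_rate \<alpha> \<delta> m (Idle e) x = 0" if "x \<noteq> Idle 0" for x
      using that True by (cases x) auto
    then show ?thesis
      using True by (subst sum_states_Idle [of 0]) auto
  next
    case False
    have "probe_rate \<alpha> \<delta> m (Idle e) x = 0" if "x \<notin> range (Busy m m)" for x
      using that False by (cases x) auto
    then show ?thesis
      using False
      by (subst sum_states_Busy [of m m m])
        (auto simp: mult.assoc sum_alpha_diff simp flip: sum_distrib_left)
  qed
  moreover have "(\<Sum>z\<in>states m. assign_rate \<alpha> m \<nu> (Idle e) z * ?f z) =
    (if e = m then \<nu> * (\<alpha> \<bullet> b 1 (m + 1) - a e) else 0)"
  proof -
    have "assign_rate \<alpha> m \<nu> (Idle e) x = 0" if "x \<notin> range (Busy 1 (m + 1))" for x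
      using that by (cases x) auto
    then show ?thesis
      by (subst sum_states_Busy [of "m + 1" m 1])
        (auto simp: mult.assoc sum_alpha_diff simp flip: sum_distrib_left)
  qed
  moreover have "phase_rate S (Idle e) z = 0" "service_rate \<alpha> S (Idle e) z = 0" for z
    by (cases z; simp)+
  ultimately show ?thesis
    by (simp add: drift_def rate_def distrib_right sum.distrib)
qed

lemma drift_Busy:
  assumes e: "e = m \<or> e = m + 1" and q: "1 \<le> q" "q \<le> e"
  shows "drift m \<nu> (test a b) (Busy q e j) =
    (S *v b q e + (if q = 1 then a e else \<alpha> \<bullet> b (q - 1) e) *\<^sub>R exit
      + \<delta> *\<^sub>R (b (max q m) (max q m) - b q e)
      + (if e = m then \<nu> *\<^sub>R (b (q + 1) (m + 1) - b q e) else 0)) $ j"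
proof -
  let ?f = "\<lambda>z. test a b z - b q e $ j"
  \<comment> \<open>The surplus term \<open>exit $ j * b q e $ j\<close> cancels against the loss
    term of the service completions.\<close>
  have phase: "(\<Sum>z\<in>states m. phase_rate S (Busy q e j) z * ?f z) =
    (S *v b q e) $ j + exit $ j * b q e $ j"
  proof -
    have "phase_rate S (Busy q e j) x = 0" if "x \<notin> range (Busy q e)" for x
      using that by (cases x) auto
    then have "(\<Sum>z\<in>states m. phase_rate S (Busy q e j) z * ?f z) =
        (\<Sum>k\<in>UNIV. S $ j $ k * (b q e $ k - b q e $ j))"
      using assms by (subst sum_states_Busy [of e m q]) (auto intro: sum.cong)
    then show ?thesis
      using S_mult_shift [of "b q e" j "b q e $ j"] by simp
  qed
  have service: "(\<Sum>z\<in>states m. service_rate \<alpha> S (Busy q e j) z * ?f z) =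
    exit $ j * ((if q = 1 then a e else \<alpha> \<bullet> b (q - 1) e) - b q e $ j)"
  proof (cases "q = 1")
    case True
    have "service_rate \<alpha> S (Busy q e j) x = 0" if "x \<noteq> Idle e" for x
      using that True by (cases x) auto
    then show ?thesis
      using True e by (subst sum_states_Idle [of e]) auto
  next
    case False
    have "service_rate \<alpha> S (Busy q e j) x = 0" if "x \<notin> range (Busy (q - 1) e)" for x
      using that False by (cases x) auto
    then show ?thesis
      using False assms
      by (subst sum_states_Busy [of e m "q - 1"])
        (auto simp: mult.assoc sum_alpha_diff simp flip: sum_distrib_left)
  qed
  have probe: "(\<Sum>z\<in>states m. probe_rate \<alpha> \<delta> m (Busy q e j) z * ?f z) =
    \<delta> * (b (max q m) (max q m) $ j - b q e $ j)"
  proof -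
    have "probe_rate \<alpha> \<delta> m (Busy q e j) x = 0" if "x \<notin> range (Busy (max q m) (max q m))" for x
      using that by (cases x) auto
    then show ?thesis
      using assms
      by (subst sum_states_Busy [of "max q m" m "max q m"])
        (auto simp: if_distrib [of "\<lambda>x. x * _"] cong: if_cong)
  qed
  have assign: "(\<Sum>z\<in>states m. assign_rate \<alpha> m \<nu> (Busy q e j) z * ?f z) =
    (if e = m then \<nu> * (b (q + 1) (m + 1) $ j - b q e $ j) else 0)"
  proof (cases "e = m")
    case True
    have "assign_rate \<alpha> m \<nu> (Busy q e j) x = 0" if "x \<notin> range (Busy (q + 1) (m + 1))" for x
      using that by (cases x) auto
    then show ?thesis
      using assms True
      by (subst sum_states_Busy [of "m + 1" m "q + 1"])
        (auto simp: if_distrib [of "\<lambda>x. x * _"] cong: if_cong)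
  next
    case False
    have "assign_rate \<alpha> m \<nu> (Busy q e j) x = 0" for x
      using False by (cases x) auto
    then show ?thesis
      using False by simp
  qed
  have "drift m \<nu> (test a b) (Busy q e j) =
    (\<Sum>z\<in>states m. phase_rate S (Busy q e j) z * ?f z)
    + (\<Sum>z\<in>states m. service_rate \<alpha> S (Busy q e j) z * ?f z)
    + (\<Sum>z\<in>states m. probe_rate \<alpha> \<delta> m (Busy q e j) z * ?f z)
    + (\<Sum>z\<in>states m. assign_rate \<alpha> m \<nu> (Busy q e j) z * ?f z)"
    by (simp add: drift_def rate_def distrib_right sum.distrib)
  then show ?thesis
    unfolding phase service probe assign by (simp add: algebra_simps)
qed

end

section \<open>Balance equations of a stationary distribution\<close>

locale stationary_push = push_policy \<alpha> S \<delta>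
  for \<alpha> :: "real^'n" and S :: "real^'n^'n" and \<delta> :: real +
  fixes m :: nat and \<nu> :: real and p :: "'n state \<Rightarrow> real"
  assumes nu_nonneg: "0 \<le> \<nu>"
    and stationary: "is_stationary \<alpha> S \<delta> m \<nu> p"
begin

lemma p_nonneg: "0 \<le> p x"
  and p_sum: "(\<Sum>x\<in>states m. p x) = 1"
  and p_null: "z \<in> states m \<Longrightarrow> (\<Sum>x\<in>states m. p x * generator \<alpha> S \<delta> m \<nu> x z) = 0"
  using stationary by (auto simp: is_stationary_def)

definition pvec :: "nat \<Rightarrow> nat \<Rightarrow> real^'n" where
  "pvec q e = (\<chi> j. p (Busy q e j))"

lemma pvec_nth [simp]: "pvec q e $ j = p (Busy q e j)"
  by (simp add: pvec_def)

lemma sum_drift: "(\<Sum>x\<in>states m. p x * drift m \<nu> g x) = 0"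
proof -
  have "(\<Sum>x\<in>states m. p x * drift m \<nu> g x) =
      (\<Sum>x\<in>states m. \<Sum>z\<in>states m. p x * generator \<alpha> S \<delta> m \<nu> x z * g z)"
    by (simp add: sum_distrib_left mult.assoc flip: sum_generator_mult)
  also have "\<dots> = (\<Sum>z\<in>states m. (\<Sum>x\<in>states m. p x * generator \<alpha> S \<delta> m \<nu> x z) * g z)"
    by (subst sum.swap) (simp add: sum_distrib_right)
  finally show ?thesis
    by (simp add: p_null)
qed

lemma balance:
  fixes a :: "nat \<Rightarrow> real" and b :: "nat \<Rightarrow> nat \<Rightarrow> real^'n"
  defines "P \<equiv> (if m = 0 then a 0 else \<alpha> \<bullet> b m m)"
    and "nxt \<equiv> \<lambda>q e. if q = 1 then a e else \<alpha> \<bullet> b (q - 1) e"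
  shows "p (Idle m) * (\<delta> * (P - a m) + \<nu> * (\<alpha> \<bullet> b 1 (m + 1) - a m))
    + p (Idle (m + 1)) * (\<delta> * (P - a (m + 1)))
    + (\<Sum>q\<in>{1..m}. pvec q m \<bullet> (S *v b q m + nxt q m *\<^sub>R exit
        + \<delta> *\<^sub>R (b m m - b q m) + \<nu> *\<^sub>R (b (q + 1) (m + 1) - b q m)))
    + (\<Sum>q\<in>{1..m + 1}. pvec q (m + 1) \<bullet> (S *v b q (m + 1) + nxt q (m + 1) *\<^sub>R exit
        + \<delta> *\<^sub>R (b (max q m) (max q m) - b q (m + 1)))) = 0"
proof -
  have busy: "(\<Sum>j\<in>UNIV. p (Busy q e j) * drift m \<nu> (test a b) (Busy q e j)) =
      pvec q e \<bullet> (S *v b q e + nxt q e *\<^sub>R exit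
        + \<delta> *\<^sub>R (b (max q m) (max q m) - b q e)
        + (if e = m then \<nu> *\<^sub>R (b (q + 1) (m + 1) - b q e) else 0))"
    if "e = m \<or> e = m + 1" "1 \<le> q" "q \<le> e" for q e
    unfolding inner_vec_def inner_real_def pvec_nth drift_Busy [OF that] nxt_def ..
  have "(\<Sum>q\<in>{1..m}. \<Sum>j\<in>UNIV. p (Busy q m j) * drift m \<nu> (test a b) (Busy q m j)) =
      (\<Sum>q\<in>{1..m}. pvec q m \<bullet> (S *v b q m + nxt q m *\<^sub>R exit
        + \<delta> *\<^sub>R (b m m - b q m) + \<nu> *\<^sub>R (b (q + 1) (m + 1) - b q m)))"
    by (intro sum.cong refl) (simp add: busy max_absorb2)
  moreover have "(\<Sum>q\<in>{1..m + 1}. \<Sum>j\<in>UNIV.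
        p (Busy q (m + 1) j) * drift m \<nu> (test a b) (Busy q (m + 1) j)) =
      (\<Sum>q\<in>{1..m + 1}. pvec q (m + 1) \<bullet> (S *v b q (m + 1) + nxt q (m + 1) *\<^sub>R exit
        + \<delta> *\<^sub>R (b (max q m) (max q m) - b q (m + 1))))"
    by (intro sum.cong refl) (subst busy; simp)
  moreover have "p (Idle m) * drift m \<nu> (test a b) (Idle m) =
      p (Idle m) * (\<delta> * (P - a m) + \<nu> * (\<alpha> \<bullet> b 1 (m + 1) - a m))"
    by (subst drift_Idle) (auto simp: P_def)
  moreover have "p (Idle (m + 1)) * drift m \<nu> (test a b) (Idle (m + 1)) =
      p (Idle (m + 1)) * (\<delta> * (P - a (m + 1)))"
    by (subst drift_Idle) (auto simp: P_def)
  moreover have "p (Idle m) * drift m \<nu> (test a b) (Idle m)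
      + (\<Sum>q\<in>{1..m}. \<Sum>j\<in>UNIV. p (Busy q m j) * drift m \<nu> (test a b) (Busy q m j))
      + (p (Idle (m + 1)) * drift m \<nu> (test a b) (Idle (m + 1))
        + (\<Sum>q\<in>{1..m + 1}. \<Sum>j\<in>UNIV.
          p (Busy q (m + 1) j) * drift m \<nu> (test a b) (Busy q (m + 1) j))) = 0"
    using sum_drift [of "test a b"] unfolding sum_states by simp
  ultimately show ?thesis
    by linarith
qed

text \<open>The form in which test functions are applied: every bracket of \<open>balance\<close>
  has been reduced to a short vector \<open>d q\<close> or \<open>d' q\<close> beforehand.\<close>

lemma balance_eq:
  assumes "\<And>q. q \<in> {1..m} \<Longrightarrow> S *v b q m + (if q = 1 then a m else \<alpha> \<bullet> b (q - 1) m) *\<^sub>R exit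
      + \<delta> *\<^sub>R (b m m - b q m) + \<nu> *\<^sub>R (b (q + 1) (m + 1) - b q m) = d q"
    and "\<And>q. q \<in> {1..m + 1} \<Longrightarrow>
      S *v b q (m + 1) + (if q = 1 then a (m + 1) else \<alpha> \<bullet> b (q - 1) (m + 1)) *\<^sub>R exit
      + \<delta> *\<^sub>R (b (max q m) (max q m) - b q (m + 1)) = d' q"
  shows "p (Idle m) * (\<delta> * ((if m = 0 then a 0 else \<alpha> \<bullet> b m m) - a m) + \<nu> * (\<alpha> \<bullet> b 1 (m + 1) - a m))
    + p (Idle (m + 1)) * (\<delta> * ((if m = 0 then a 0 else \<alpha> \<bullet> b m m) - a (m + 1)))
    + (\<Sum>q\<in>{1..m}. pvec q m \<bullet> d q) + (\<Sum>q\<in>{1..m + 1}. pvec q (m + 1) \<bullet> d' q) = 0"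
proof -
  have "(\<Sum>q\<in>{1..m}. pvec q m \<bullet> d q) =
    (\<Sum>q\<in>{1..m}. pvec q m \<bullet> (S *v b q m + (if q = 1 then a m else \<alpha> \<bullet> b (q - 1) m) *\<^sub>R exit
      + \<delta> *\<^sub>R (b m m - b q m) + \<nu> *\<^sub>R (b (q + 1) (m + 1) - b q m)))"
    by (rule sum.cong [OF refl]) (simp only: assms(1))
  moreover have "(\<Sum>q\<in>{1..m + 1}. pvec q (m + 1) \<bullet> d' q) =
    (\<Sum>q\<in>{1..m + 1}. pvec q (m + 1) \<bullet>
      (S *v b q (m + 1) + (if q = 1 then a (m + 1) else \<alpha> \<bullet> b (q - 1) (m + 1)) *\<^sub>R exit
      + \<delta> *\<^sub>R (b (max q m) (max q m) - b q (m + 1))))"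
    by (rule sum.cong [OF refl]) (simp only: assms(2))
  ultimately show ?thesis
    using balance [of a b] by (simp only:)
qed

section \<open>Total idle and busy masses\<close>

definition idle :: real where "idle = p (Idle m) + p (Idle (m + 1))"

definition load :: real where "load = 1 - idle"

definition busy :: "real^'n" where
  "busy = (\<Sum>q\<in>{1..m}. pvec q m) + (\<Sum>q\<in>{1..m + 1}. pvec q (m + 1))"

lemma busy_inner:
  "busy \<bullet> v = (\<Sum>q\<in>{1..m}. pvec q m \<bullet> v) + (\<Sum>q\<in>{1..m + 1}. pvec q (m + 1) \<bullet> v)"
  unfolding busy_def by (simp only: inner_add_left inner_sum_left)

lemma busy_inner_one: "busy \<bullet> 1 = load"
  using p_sum unfolding sum_states busy_inner load_def idle_def
  by (simp add: inner_vec_def)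

text \<open>For S h = -v, take h in all busy states and its \<alpha>-average in all idle ones.
  Probes and assignments then have zero drift, and only the flow of completions
  \<open>busy \<bullet> exit\<close> is unknown. The case v = 1 identifies it as
  \<open>load\<close>, because the mean job size is 1.\<close>

lemma busy_eq: "busy \<bullet> v = load * (\<alpha> \<bullet> resolvent 0 v)"
proof -
  have flow: "busy \<bullet> v = (\<alpha> \<bullet> resolvent 0 v) * (busy \<bullet> exit)" for v
  proof -
    define h where "h = resolvent 0 v"
    have "S *v h = - v"
      by (simp add: h_def S_mult_resolvent)
    then have "busy \<bullet> (- v + (\<alpha> \<bullet> h) *\<^sub>R exit) = 0"
      using balance [of "\<lambda>_. \<alpha> \<bullet> h" "\<lambda>_ _. h"] unfolding busy_inner by (simp cong: if_cong)
    then show ?thesis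
      by (simp add: inner_diff_right h_def)
  qed
  from flow [of 1] have "load = busy \<bullet> exit"
    by (simp add: busy_inner_one alpha_resolvent_0_one)
  then show ?thesis
    using flow [of v] by simp
qed

definition u :: "real^'n" where "u = resolvent \<delta> exit"

lemma S_mult_u: "S *v u = \<delta> *\<^sub>R u - exit"
  using delta_pos by (simp add: u_def S_mult_resolvent)

lemma alpha_u: "\<alpha> \<bullet> u = y \<delta>"
  by (simp add: u_def y_eq)

lemma alpha_resolvent_0_u: "\<delta> * (\<alpha> \<bullet> resolvent 0 u) = 1 - y \<delta>"
  using arg_cong [OF resolvent_identity [of 0 \<delta> exit], of "inner \<alpha>"] delta_pos
  by (simp add: u_def inner_diff_right resolvent_0_exit alpha_inner_one y_eq)

text \<open>With \<open>e = m\<close> the queue would have length \<open>q + 1\<close> after the next assignment. Counting that job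
  already, the test function is the probability that the server empties before a probe.\<close>

lemma idle_balance:
  "y \<delta> ^ m * load * (1 - y \<delta>) =
    \<delta> * (p (Idle m) * (y \<delta> - y \<delta> ^ (m + 1)) + p (Idle (m + 1)) * (1 - y \<delta> ^ (m + 1)))"
proof -
  define Y where "Y = y \<delta>"
  \<comment> \<open>With n = q + 1 for e = m and n = q for e = m + 1, the values are Y^n in idle
    states and Y^(n-1) u in busy ones.\<close>
  define a where "a e = (if e = m then Y else 1)" for e
  define b where "b q e = Y ^ (if e = m then q else q - 1) *\<^sub>R u" for q e
  have inner_b: "\<alpha> \<bullet> b q e = Y ^ (if e = m then q else q - 1) * Y" for q e
    by (simp add: b_def Y_def alpha_u)
  have nxt: "(if q = 1 then a e else \<alpha> \<bullet> b (q - 1) e) = Y ^ (if e = m then q else q - 1)"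
    if "1 \<le> q" for q e
  proof (cases "q = 1")
    case False
    then have "q = Suc (Suc (q - 2))"
      using that by (simp; arith)
    then obtain k where "q = Suc (Suc k)"
      by blast
    then show ?thesis
      by (simp add: inner_b)
  qed (simp add: a_def)
  \<comment> \<open>An assignment preserves n, and a probe in a busy state always leads to n = m +
    1. Hence the drift is the same vector in all busy states.\<close>
  have 1: "S *v b q m + (if q = 1 then a m else \<alpha> \<bullet> b (q - 1) m) *\<^sub>R exit
      + \<delta> *\<^sub>R (b m m - b q m) + \<nu> *\<^sub>R (b (q + 1) (m + 1) - b q m) = (\<delta> * Y ^ m) *\<^sub>R u"
    if "q \<in> {1..m}" for q
    using that by (subst nxt) (simp_all add: b_def matrix_vector_mult_scaleR S_mult_u algebra_simps)
  have 2: "S *v b q (m + 1) + (if q = 1 then a (m + 1) else \<alpha> \<bullet> b (q - 1) (m + 1)) *\<^sub>R exit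
      + \<delta> *\<^sub>R (b (max q m) (max q m) - b q (m + 1)) = (\<delta> * Y ^ m) *\<^sub>R u"
    if "q \<in> {1..m + 1}" for q
  proof -
    have "b (max q m) (max q m) = Y ^ m *\<^sub>R u"
      using that by (cases "q = m + 1") (simp_all add: b_def max_absorb2)
    then show ?thesis
      using that
      by (subst nxt) (simp_all add: b_def matrix_vector_mult_scaleR S_mult_u algebra_simps)
  qed
  have P: "(if m = 0 then a 0 else \<alpha> \<bullet> b m m) = Y ^ (m + 1)"
    by (simp add: a_def inner_b)
  have "p (Idle m) * (\<delta> * (Y ^ (m + 1) - Y)) + p (Idle (m + 1)) * (\<delta> * (Y ^ (m + 1) - 1))
      + busy \<bullet> ((\<delta> * Y ^ m) *\<^sub>R u) = 0"
    using balance_eq [OF 1 2] unfolding P busy_inner by (simp add: inner_b a_def)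
  moreover have "busy \<bullet> ((\<delta> * Y ^ m) *\<^sub>R u) = Y ^ m * load * (\<delta> * (\<alpha> \<bullet> resolvent 0 u))"
    by (simp add: busy_eq)
  ultimately show ?thesis
    unfolding alpha_resolvent_0_u Y_def by (simp add: algebra_simps)
qed

text \<open>For m = 0 the only state with e = 0 is \<open>Idle 0\<close>: assignments leave it, and
  probes at \<open>Idle 1\<close> enter it.\<close>

lemma idle_balance_0:
  assumes "m = 0"
  shows "\<nu> * p (Idle 0) = \<delta> * p (Idle 1)"
  using balance [of "\<lambda>e. if e = 0 then 1 else 0" "\<lambda>_ _. 0"] assms by (simp add: mult.commute)

text \<open>The flow between idle and busy states. For m = 0 probes do not create work, so only an
  assignment at \<open>Idle 0\<close> starts a service.\<close>

lemma pvec_balance_0: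
  assumes "m = 0"
  shows "pvec 1 1 \<bullet> exit = \<nu> * p (Idle 0)"
  using balance [of "\<lambda>_. 0" "\<lambda>_ _. 1"] assms
  by (simp add: alpha_inner_one exit_rate_def algebra_simps)

text \<open>The states with e = m and q < m are entered only by a service completion in (m, m, j).
  The m - 1 services still ahead all finish before the next probe or assignment with probability
  z^(m-1), and \<open>Idle m\<close> is left at rate \<nu> + \<delta>.\<close>

lemma pvec_m_inner_exit:
  assumes "1 \<le> m"
  shows "(\<nu> + \<delta>) * p (Idle m) = y (\<nu> + \<delta>) ^ (m - 1) * (pvec m m \<bullet> exit)"
proof -
  define z where "z = y (\<nu> + \<delta>)"
  define w where "w = resolvent (\<nu> + \<delta>) exit"
  have S_w: "S *v w = (\<nu> + \<delta>) *\<^sub>R w - exit"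
    using delta_pos nu_nonneg by (simp add: w_def S_mult_resolvent)
  have alpha_w: "\<alpha> \<bullet> w = z"
    by (simp add: w_def z_def y_eq)
  define a :: "nat \<Rightarrow> real" where "a e = (if e = m then 1 else 0)" for e
  \<comment> \<open>Probes land at q = m, so the cut at q < m keeps them from entering the
    support.\<close>
  define b where "b q e = (if e = m \<and> q < m then z ^ (q - 1) *\<^sub>R w else 0)" for q e
  have nxt: "(if q = 1 then a m else \<alpha> \<bullet> b (q - 1) m) = z ^ (q - 1)" if "q \<in> {1..m}" for q
  proof (cases "q = 1")
    case False
    then have "q = Suc (Suc (q - 2))"
      using that by (simp; arith)
    then obtain k where "q = Suc (Suc k)"
      by blast
    then show ?thesis
      using that by (simp add: b_def alpha_w)
  qed (simp add: a_def)
  have 1: "S *v b q m + (if q = 1 then a m else \<alpha> \<bullet> b (q - 1) m) *\<^sub>R exit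
      + \<delta> *\<^sub>R (b m m - b q m) + \<nu> *\<^sub>R (b (q + 1) (m + 1) - b q m)
      = (if q = m then z ^ (m - 1) else 0) *\<^sub>R exit"
    if "q \<in> {1..m}" for q
    using that by (subst nxt) (simp_all add: b_def matrix_vector_mult_scaleR S_w algebra_simps)
  have 2: "S *v b q (m + 1) + (if q = 1 then a (m + 1) else \<alpha> \<bullet> b (q - 1) (m + 1)) *\<^sub>R exit
      + \<delta> *\<^sub>R (b (max q m) (max q m) - b q (m + 1)) = 0"
    if "q \<in> {1..m + 1}" for q
    by (simp add: b_def a_def)
  have P: "(if m = 0 then a 0 else \<alpha> \<bullet> b m m) = 0" and b1: "b 1 (m + 1) = 0"
    using assms by (simp_all add: b_def)
  have "(\<Sum>q\<in>{1..m}. pvec q m \<bullet> ((if q = m then z ^ (m - 1) else 0) *\<^sub>R exit))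
      = pvec m m \<bullet> (z ^ (m - 1) *\<^sub>R exit)"
    using assms by (subst sum.remove [of _ m]) (auto intro!: sum.neutral)
  then have "p (Idle m) * (- \<delta> - \<nu>) + pvec m m \<bullet> (z ^ (m - 1) *\<^sub>R exit) = 0"
    using balance_eq [OF 1 2] unfolding P b1 by (simp add: a_def del: inner_scaleR_right)
  then show ?thesis
    unfolding z_def by (simp add: algebra_simps)
qed

text \<open>A probe sends every state to (m, m, j) for some j, except that it fixes (m + 1, m + 1,
  j). So for functions supported on these two levels the inflow by probes involves only
  \<open>busy\<close> and \<open>idle\<close>, up to a correction at the top level.\<close>

lemma full_balance:
  assumes "1 \<le> m"
  shows "\<delta> * (busy \<bullet> h) + \<delta> * (\<alpha> \<bullet> h) * idle
    + pvec m m \<bullet> (S *v h - (\<nu> + \<delta>) *\<^sub>R h + \<nu> *\<^sub>R k)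
    + pvec (m + 1) (m + 1) \<bullet> (S *v k - \<delta> *\<^sub>R h) = 0"
proof -
  define a :: "nat \<Rightarrow> real" where "a e = 0" for e
  define b where "b q e = (if q = m \<and> e = m then h else if q = m + 1 \<and> e = m + 1 then k else 0)"
    for q e
  have 1: "S *v b q m + (if q = 1 then a m else \<alpha> \<bullet> b (q - 1) m) *\<^sub>R exit
      + \<delta> *\<^sub>R (b m m - b q m) + \<nu> *\<^sub>R (b (q + 1) (m + 1) - b q m)
      = \<delta> *\<^sub>R h + (if q = m then S *v h - (\<nu> + \<delta>) *\<^sub>R h + \<nu> *\<^sub>R k else 0)"
    if "q \<in> {1..m}" for q
    using that by (auto simp: b_def a_def algebra_simps)
  have 2: "S *v b q (m + 1) + (if q = 1 then a (m + 1) else \<alpha> \<bullet> b (q - 1) (m + 1)) *\<^sub>R exit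
      + \<delta> *\<^sub>R (b (max q m) (max q m) - b q (m + 1))
      = \<delta> *\<^sub>R h + (if q = m + 1 then S *v k - \<delta> *\<^sub>R h else 0)"
    if "q \<in> {1..m + 1}" for q
    using that assms by (auto simp: b_def a_def max_def algebra_simps)
  have P: "(if m = 0 then a 0 else \<alpha> \<bullet> b m m) = \<alpha> \<bullet> h" and b1: "b 1 (m + 1) = 0"
    using assms by (simp_all add: b_def)
  have last: "(\<Sum>q\<in>{1..n}. pvec q e \<bullet> (if q = n then c else 0)) = pvec n e \<bullet> c" if "1 \<le> n" for n e c
    using that by (subst sum.remove [of _ n]) (auto intro!: sum.neutral)
  have "p (Idle m) * (\<delta> * (\<alpha> \<bullet> h)) + p (Idle (m + 1)) * (\<delta> * (\<alpha> \<bullet> h))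
    + (\<Sum>q\<in>{1..m}. pvec q m \<bullet> (\<delta> *\<^sub>R h + (if q = m then S *v h - (\<nu> + \<delta>) *\<^sub>R h + \<nu> *\<^sub>R k else 0)))
    + (\<Sum>q\<in>{1..m + 1}. pvec q (m + 1) \<bullet> (\<delta> *\<^sub>R h + (if q = m + 1 then S *v k - \<delta> *\<^sub>R h else 0))) = 0"
    using balance_eq [OF 1 2] unfolding P b1 by (simp only: a_def) simp
  then show ?thesis
    using last [of m m] last [of "m + 1" "m + 1"] assms
    unfolding busy_inner idle_def inner_add_right sum.distrib
    by (simp add: algebra_simps sum_distrib_left del: sum.cl_ivl_Suc)
qed

text \<open>With \<open>k = - \<delta> x\<close> the contribution of the states \<open>(m + 1, m + 1, j)\<close> to the previous balance
  equation vanishes, and \<open>h = u - \<nu> x\<close> reduces that of the states \<open>(m, m, j)\<close> to the exit rate.\<close>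

lemma full_idle_balance:
  assumes "1 \<le> m"
  shows "(\<nu> + \<delta>) * p (Idle m) = \<delta> * y (\<nu> + \<delta>) ^ (m - 1) *
    (load * (\<alpha> \<bullet> resolvent \<nu> u) + idle * (y \<nu> - \<delta> * (\<alpha> \<bullet> resolvent \<nu> u)))"
proof -
  \<comment> \<open>To remove the top level, S k = \<delta> h is solved by h = - S x and k = -
    \<delta> x. The requirement at level m then reads (\<nu> I - S) (\<delta> I - S) x = exit, which
    gives this x; also \<open>resolvent 0 h\<close> = x, as \<open>busy_eq\<close> needs.\<close>
  define x where "x = resolvent \<nu> u"
  define h where "h = u - \<nu> *\<^sub>R x"
  define k where "k = - \<delta> *\<^sub>R x"
  have S_x: "S *v x = \<nu> *\<^sub>R x - u"
    using nu_nonneg by (simp add: x_def S_mult_resolvent)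
  have "S *v h - (\<nu> + \<delta>) *\<^sub>R h + \<nu> *\<^sub>R k = - exit"
    by (simp add: h_def k_def matrix_vector_mult_diff_distrib matrix_vector_mult_scaleR S_x S_mult_u
        algebra_simps)
  moreover have "S *v k - \<delta> *\<^sub>R h = 0"
  proof -
    have "S *v k = (- \<delta>) *\<^sub>R (S *v x)"
      unfolding k_def by (rule matrix_vector_mult_scaleR)
    then show ?thesis
      by (simp add: h_def S_x algebra_simps)
  qed
  ultimately have "pvec m m \<bullet> exit = \<delta> * (busy \<bullet> h) + \<delta> * (\<alpha> \<bullet> h) * idle"
    using full_balance [OF assms, of h k] by simp
  moreover have "resolvent 0 h = x"
    by (rule resolvent_unique) (simp_all add: h_def S_x)
  moreover have "\<alpha> \<bullet> h = y \<nu> - \<delta> * (\<alpha> \<bullet> x)"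
  proof -
    have "resolvent \<nu> exit = h + \<delta> *\<^sub>R x"
      using nu_nonneg
      by (intro resolvent_unique)
        (simp_all add: h_def matrix_vector_right_distrib matrix_vector_mult_diff_distrib
          matrix_vector_mult_scaleR S_x S_mult_u algebra_simps)
    then show ?thesis
      by (simp add: y_eq inner_add_right)
  qed
  ultimately have eq: "pvec m m \<bullet> exit = \<delta> * (load * (\<alpha> \<bullet> x)) + \<delta> * (y \<nu> - \<delta> * (\<alpha> \<bullet> x)) * idle"
    by (simp add: busy_eq)
  show ?thesis
    unfolding pvec_m_inner_exit [OF assms] eq by (simp add: x_def algebra_simps)
qed

end

section \<open>Monotonicity in the parameters\<close>

context phase_type_dist
begin

text \<open>The o_m of the overview as a geometric sum. The quotient in \<open>lambda_thr\<close> is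
  0/0 at probe rate 0, where y = 1; the sum is continuous there, and its monotonicity in d and m is
  visible term by term.\<close>

definition odds :: "real \<Rightarrow> nat \<Rightarrow> real" where
  "odds d m = d * (\<Sum>k<m. (1 / y d) ^ k)"

lemma odds_0 [simp]: "odds d 0 = 0"
  and odds_1 [simp]: "odds d (Suc 0) = d"
  and odds_Suc: "odds d (Suc m) = odds d m + d / y d ^ m"
  by (simp_all add: odds_def distrib_left power_one_over)

lemma odds_less_Suc: "0 < d \<Longrightarrow> odds d m < odds d (Suc m)"
  using y_pos [of d] by (simp add: odds_Suc)

lemma odds_mono: "0 < d \<Longrightarrow> m \<le> n \<Longrightarrow> odds d m \<le> odds d n"
  by (rule lift_Suc_mono_le) (auto intro: less_imp_le odds_less_Suc)

lemma odds_nonneg: "0 < d \<Longrightarrow> 0 \<le> odds d m"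
  using odds_mono [of d 0 m] by simp

lemma odds_ge: "0 < d \<Longrightarrow> 1 \<le> m \<Longrightarrow> d \<le> odds d m"
  using odds_mono [of d 1 m] by simp

lemma odds_closed_form:
  assumes "0 < d"
  shows "odds d m * (y d ^ m * (1 - y d)) = d * y d * (1 - y d ^ m)"
proof (induction m)
  case (Suc m)
  have "odds d (Suc m) * (y d ^ Suc m * (1 - y d)) =
      y d * (odds d m * (y d ^ m * (1 - y d))) + d / y d ^ m * (y d ^ Suc m * (1 - y d))"
    by (simp add: odds_Suc algebra_simps)
  also have "d / y d ^ m * (y d ^ Suc m * (1 - y d)) = d * y d * (1 - y d)"
    using y_pos [of d] assms by (simp add: field_simps)
  finally show ?case
    unfolding Suc.IH by (simp add: algebra_simps)
qed simp

lemma lambda_thr_eq: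
  assumes "0 < d"
  shows "lambda_thr \<alpha> S d m = odds d m / (1 + odds d m)"
proof -
  have cancel: "x * c / (x * c + c) = x / (1 + x)" if "0 < c" for x c :: real
  proof -
    have "x * c + c = (1 + x) * c"
      by (simp add: algebra_simps)
    then show ?thesis
      using that by simp
  qed
  have "0 < y d ^ m * (1 - y d)"
    using y_pos [of d] y_less_1 [of d] assms by simp
  then show ?thesis
    unfolding lambda_thr_def Let_def odds_closed_form [OF assms, symmetric] by (rule cancel)
qed

text \<open>The factor y^(m-1) (1 - y) / (1 - y^m) equals d / \<open>odds d m\<close>.\<close>

lemma is_delta_thr_iff:
  assumes "1 \<le> m"
  shows "is_delta_thr \<alpha> S lam m d \<longleftrightarrow> 0 < d \<and> odds d m = lam / (1 - lam)"
proof (cases "0 < d")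
  case True
  define Y where "Y = y d"
  have Y: "0 < Y" "Y < 1"
    using True y_pos [of d] y_less_1 [of d] by (auto simp: Y_def)
  then have "Y ^ m < 1"
    using assms by (simp add: power_less_one_iff)
  obtain k where m: "m = Suc k"
    using assms by (cases m) auto
  have "odds d m * (Y ^ k * (1 - Y)) = d * (1 - Y ^ m)"
    using odds_closed_form [OF True, of m] Y by (simp add: m flip: Y_def)
  moreover have "0 < Y ^ k * (1 - Y)"
    using Y by simp
  ultimately have "d = Y ^ k * (1 - Y) / (1 - Y ^ m) * odds d m"
    using \<open>Y ^ m < 1\<close> by (simp add: field_simps)
  moreover have "0 < Y ^ k * (1 - Y) / (1 - Y ^ m)"
    using Y \<open>Y ^ m < 1\<close> by simp
  ultimately have "d = Y ^ k * (1 - Y) / (1 - Y ^ m) * x \<longleftrightarrow> odds d m = x" for x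
    by (metis mult_left_cancel less_irrefl)
  then have "d = Y ^ k * (1 - Y) / (1 - Y ^ m) * (lam / (1 - lam)) \<longleftrightarrow> odds d m = lam / (1 - lam)" .
  then show ?thesis
    using True unfolding is_delta_thr_def Let_def Y_def m by (simp only: diff_Suc_1 simp_thms)
qed (simp add: is_delta_thr_def)

lemma odds_strict_mono:
  assumes "0 < c" "c < d" "1 \<le> m"
  shows "odds c m < odds d m"
proof -
  have "1 / y c \<le> 1 / y d"
    using assms y_antimono [of c d] y_pos [of d] by (simp add: frac_le)
  then have "(\<Sum>k<m. (1 / y c) ^ k) \<le> (\<Sum>k<m. (1 / y d) ^ k)"
    using assms y_pos [of c] by (intro sum_mono power_mono) auto
  moreover have "0 < (\<Sum>k<m. (1 / y c) ^ k)"
    using assms y_pos [of c] by (intro sum_pos) (auto simp: lessThan_empty_iff)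
  ultimately show ?thesis
    unfolding odds_def using assms by (intro mult_less_le_imp_less) auto
qed

lemma odds_eq_ex1:
  assumes "0 < x" "1 \<le> m"
  shows "\<exists>!d. 0 < d \<and> odds d m = x"
proof -
  have "y d \<noteq> 0" if "d \<in> {0..}" for d
    using that y_pos [of d] by simp
  then have "continuous_on {0..x} (\<lambda>d. odds d m)"
    unfolding odds_def
    by (intro continuous_intros continuous_on_subset [OF continuous_y]) auto
  moreover have "odds 0 m = 0"
    by (simp add: odds_def)
  \<comment> \<open>The upper end x of the interval suffices because \<open>odds x m\<close> is at
    least x.\<close>
  ultimately obtain d where d: "0 \<le> d" "d \<le> x" "odds d m = x"
    using IVT' [of "\<lambda>d. odds d m" 0 x x] odds_ge [OF assms] assms by auto
  have "0 < d"
    using d \<open>odds 0 m = 0\<close> assms by (cases "d = 0") auto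
  show ?thesis
  proof (intro ex1I [of _ d] conjI)
    fix d' assume "0 < d' \<and> odds d' m = x"
    then show "d' = d"
      using odds_strict_mono [of d d' m] odds_strict_mono [of d' d m] d \<open>0 < d\<close> assms
      by (cases d d' rule: linorder_cases) auto
  qed (use d \<open>0 < d\<close> in auto)
qed

end

section \<open>The share of the idle mass that sits at \<open>Idle m\<close>, as a function of \<nu>
  and L\<close>

context push_policy
begin

text \<open>By the resolvent identity this is the divided difference (y \<nu> - y \<delta>) /
  (\<delta> - \<nu>) for \<nu> different from \<delta>. The composed resolvents have no singularity
  at \<nu> = \<delta>, and their sign and monotonicity are inherited from single resolvents.\<close>

definition transit :: "real \<Rightarrow> real" where
  "transit \<nu> = \<alpha> \<bullet> resolvent \<nu> (resolvent \<delta> exit)"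

text \<open>The bracket of \<open>full_idle_balance\<close> divided by \<open>idle\<close>, with L =
  load / idle. The value 1 at m = 0 comes from \<open>idle_balance_0\<close>.\<close>

definition idle_factor :: "nat \<Rightarrow> real \<Rightarrow> real \<Rightarrow> real" where
  "idle_factor m \<nu> L =
    (if m = 0 then 1 else y (\<nu> + \<delta>) ^ (m - 1) * ((L - \<delta>) * transit \<nu> + y \<nu>))"

text \<open>The function f(nu, L) of the overview.\<close>

definition idle_frac :: "nat \<Rightarrow> real \<Rightarrow> real \<Rightarrow> real" where
  "idle_frac m \<nu> L = \<delta> / (\<nu> + \<delta>) * idle_factor m \<nu> L"

lemma resolvent_delta_exit_nonneg: "0 \<le> resolvent \<delta> exit $ i"
  using delta_pos by (intro resolvent_nonneg exit_nonneg) simp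

lemma transit_nonneg: "0 \<le> \<nu> \<Longrightarrow> 0 \<le> transit \<nu>"
  unfolding transit_def by (intro alpha_inner_nonneg resolvent_nonneg resolvent_delta_exit_nonneg)

lemma transit_antimono: "0 \<le> \<nu> \<Longrightarrow> \<nu> \<le> \<mu> \<Longrightarrow> transit \<mu> \<le> transit \<nu>"
  unfolding transit_def by (intro alpha_resolvent_antimono resolvent_delta_exit_nonneg)

lemma transit_0: "\<delta> * transit 0 = 1 - y \<delta>"
  using arg_cong [OF resolvent_identity [of 0 \<delta> exit], of "inner \<alpha>"] delta_pos
  by (simp add: transit_def inner_diff_right resolvent_0_exit alpha_inner_one y_eq)

text \<open>For \<open>m \<noteq> 0\<close> the factor \<open>L - \<delta>\<close> of the decreasing function \<open>transit\<close> in \<open>idle_factor\<close> must be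
  nonnegative for \<open>idle_factor\<close> to decrease in \<open>\<nu>\<close>.\<close>

lemma delta_le_if_odds_le: "odds \<delta> m \<le> L \<Longrightarrow> m \<noteq> 0 \<Longrightarrow> \<delta> \<le> L"
  using odds_ge [OF delta_pos, of m] by simp

lemma idle_factor_pos:
  assumes "0 \<le> \<nu>" "odds \<delta> m \<le> L"
  shows "0 < idle_factor m \<nu> L"
  using assms delta_pos delta_le_if_odds_le [OF assms(2)]
  by (auto simp: idle_factor_def y_pos transit_nonneg intro!: mult_pos_pos add_nonneg_pos)

lemma idle_factor_antimono:
  assumes "0 \<le> \<nu>" "\<nu> \<le> \<mu>" "odds \<delta> m \<le> L"
  shows "idle_factor m \<mu> L \<le> idle_factor m \<nu> L"
proof (cases "m = 0")
  case False
  have "(L - \<delta>) * transit \<mu> + y \<mu> \<le> (L - \<delta>) * transit \<nu> + y \<nu>"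
    using assms delta_le_if_odds_le [OF assms(3) False]
    by (intro add_mono mult_left_mono transit_antimono y_antimono) auto
  moreover have "y (\<mu> + \<delta>) ^ (m - 1) \<le> y (\<nu> + \<delta>) ^ (m - 1)"
    using assms delta_pos y_pos [of "\<mu> + \<delta>"] by (intro power_mono y_antimono) auto
  moreover have "0 \<le> (L - \<delta>) * transit \<mu> + y \<mu>"
    using assms delta_le_if_odds_le [OF assms(3) False]
    by (intro add_nonneg_nonneg mult_nonneg_nonneg transit_nonneg less_imp_le [OF y_pos]) auto
  moreover have "0 \<le> y (\<nu> + \<delta>) ^ (m - 1)"
    using assms delta_pos by (intro zero_le_power less_imp_le [OF y_pos]) auto
  ultimately show ?thesis
    using False by (simp add: idle_factor_def mult_mono)
qed (simp add: idle_factor_def)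

lemma idle_frac_pos: "0 \<le> \<nu> \<Longrightarrow> odds \<delta> m \<le> L \<Longrightarrow> 0 < idle_frac m \<nu> L"
  using delta_pos by (simp add: idle_frac_def idle_factor_pos)

lemma idle_frac_strict_antimono:
  assumes "0 \<le> \<nu>" "\<nu> < \<mu>" "odds \<delta> m \<le> L"
  shows "idle_frac m \<mu> L < idle_frac m \<nu> L"
proof -
  have "\<delta> / (\<mu> + \<delta>) < \<delta> / (\<nu> + \<delta>)"
    using assms delta_pos by (simp add: divide_strict_left_mono)
  then show ?thesis
    unfolding idle_frac_def
    using assms delta_pos idle_factor_antimono [of \<nu> \<mu> m L] idle_factor_pos [of \<mu> m L]
    by (intro mult_less_le_imp_less) auto
qed

lemma idle_frac_mono_odds:
  assumes "0 \<le> \<nu>" "L \<le> L'"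
  shows "idle_frac m \<nu> L \<le> idle_frac m \<nu> L'"
proof -
  have "(L - \<delta>) * transit \<nu> \<le> (L' - \<delta>) * transit \<nu>"
    using assms by (intro mult_right_mono transit_nonneg) auto
  then have "idle_factor m \<nu> L \<le> idle_factor m \<nu> L'"
    using assms delta_pos y_pos [of "\<nu> + \<delta>"] by (simp add: idle_factor_def)
  then show ?thesis
    unfolding idle_frac_def using assms delta_pos by (intro mult_left_mono) auto
qed

text \<open>Without assignments the states with e = m + 1 die out, so all idle mass belongs at
  \<open>Idle m\<close>. This value anchors the intermediate value argument at \<nu> = 0.\<close>

lemma idle_frac_0: "idle_frac m 0 (odds \<delta> m) = 1"
proof (cases m)
  case (Suc k)
  define Y where "Y = y \<delta>"
  have Y: "0 < Y" "Y < 1"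
    using delta_pos y_pos [of \<delta>] y_less_1 [of \<delta>] by (auto simp: Y_def)
  have "odds \<delta> m * (Y ^ k * (1 - Y)) = \<delta> * (1 - Y ^ m)"
    using odds_closed_form [OF delta_pos, of m] Y by (simp add: Suc flip: Y_def)
  moreover have "\<delta> * (Y ^ k * (odds \<delta> m * transit 0)) = odds \<delta> m * (Y ^ k * (\<delta> * transit 0))"
    by (simp add: algebra_simps)
  ultimately have "\<delta> * (Y ^ k * (odds \<delta> m * transit 0)) = \<delta> * (1 - Y ^ m)"
    unfolding transit_0 by (simp add: Y_def)
  then have "Y ^ k * (odds \<delta> m * transit 0) = 1 - Y ^ m"
    using delta_pos by simp
  moreover have "idle_frac m 0 (odds \<delta> m) =
      Y ^ k * (odds \<delta> m * transit 0) - Y ^ k * (\<delta> * transit 0) + Y ^ k"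
    using delta_pos by (simp add: idle_frac_def idle_factor_def Suc y_0 Y_def algebra_simps)
  ultimately show ?thesis
    unfolding transit_0 by (simp add: Suc algebra_simps flip: Y_def)
qed (use delta_pos in \<open>simp add: idle_frac_def idle_factor_def\<close>)

lemma continuous_idle_frac: "continuous_on {0..} (\<lambda>\<nu>. idle_frac m \<nu> L)"
proof -
  have "continuous_on {0..} (\<lambda>\<nu>. y (\<nu> + \<delta>))"
    using delta_pos
    by (intro continuous_on_compose2 [OF continuous_y] continuous_intros) auto
  moreover have "continuous_on {0..} transit"
    unfolding transit_def by (intro continuous_alpha_resolvent resolvent_delta_exit_nonneg)
  moreover have "\<nu> + \<delta> \<noteq> 0" if "\<nu> \<in> {0..}" for \<nu>
    using that delta_pos by simp
  ultimately show ?thesis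
    unfolding idle_frac_def idle_factor_def
    by (cases "m = 0") (auto intro!: continuous_intros continuous_y)
qed

lemma idle_frac_surj:
  assumes "0 < t" "t \<le> 1" "odds \<delta> m \<le> L"
  obtains \<nu> where "0 \<le> \<nu>" "idle_frac m \<nu> L = t"
proof -
  have "1 \<le> idle_frac m 0 L"
    using idle_frac_mono_odds [of 0 "odds \<delta> m" L m] assms idle_frac_0 by simp
  \<comment> \<open>Chosen so that \<delta> / N times the factor at 0 is t; since the factor
    decreases in \<nu>, the value at N is at most t.\<close>
  define N where "N = \<delta> * idle_factor m 0 L / t"
  have "0 < N"
    using assms delta_pos by (simp add: N_def idle_factor_pos)
  have "idle_frac m N L \<le> \<delta> / (N + \<delta>) * idle_factor m 0 L"
    unfolding idle_frac_def
    using \<open>0 < N\<close> delta_pos assms by (intro mult_left_mono idle_factor_antimono) auto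
  also have "\<dots> = N * t / (N + \<delta>)"
    using assms by (simp add: N_def)
  also have "\<dots> \<le> t"
    using \<open>0 < N\<close> delta_pos assms by (simp add: field_simps)
  finally have "idle_frac m N L \<le> t" .
  moreover have "continuous_on {0..N} (\<lambda>\<nu>. idle_frac m \<nu> L)"
    by (rule continuous_on_subset [OF continuous_idle_frac]) auto
  ultimately show thesis
    using IVT2' [of "\<lambda>\<nu>. idle_frac m \<nu> L" N t 0] \<open>1 \<le> idle_frac m 0 L\<close> assms \<open>0 < N\<close> that
    by auto
qed

end

section \<open>The equation linking L and \<nu> for a stationary distribution\<close>

context stationary_push
begin

text \<open>This is \<open>idle_balance\<close> divided by y^m (1 - y);
  \<open>odds_closed_form\<close> turns the two coefficients into \<open>odds\<close>.\<close>

lemma load_eq: "load = p (Idle m) * odds \<delta> m + p (Idle (m + 1)) * odds \<delta> (m + 1)"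
proof -
  define c where "c = y \<delta> ^ m * (1 - y \<delta>)"
  have Y: "0 < y \<delta>" "y \<delta> < 1"
    using delta_pos y_pos [of \<delta>] y_less_1 [of \<delta>] by auto
  then have "0 < c"
    by (simp add: c_def)
  have "odds \<delta> m * c = \<delta> * (y \<delta> - y \<delta> ^ (m + 1))"
    using odds_closed_form [OF delta_pos, of m] by (simp add: c_def algebra_simps)
  moreover have "odds \<delta> (m + 1) * c = \<delta> * (1 - y \<delta> ^ (m + 1))"
    using odds_closed_form [OF delta_pos, of "m + 1"] Y by (simp add: c_def)
  moreover have "load * c =
      p (Idle m) * (\<delta> * (y \<delta> - y \<delta> ^ (m + 1))) + p (Idle (m + 1)) * (\<delta> * (1 - y \<delta> ^ (m + 1)))"
    using idle_balance by (simp add: c_def algebra_simps)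
  ultimately have "load * c = (p (Idle m) * odds \<delta> m + p (Idle (m + 1)) * odds \<delta> (m + 1)) * c"
    by (metis distrib_right mult.assoc)
  then show ?thesis
    using \<open>0 < c\<close> by simp
qed

lemma idle_pos: "0 < idle"
proof -
  have "idle \<noteq> 0"
  proof
    assume "idle = 0"
    then have "p (Idle m) = 0" "p (Idle (m + 1)) = 0"
      unfolding idle_def using p_nonneg [of "Idle m"] p_nonneg [of "Idle (m + 1)"] by linarith+
    then have "load = 0"
      using load_eq by simp
    with \<open>idle = 0\<close> show False
      by (simp add: load_def)
  qed
  then show ?thesis
    using p_nonneg [of "Idle m"] p_nonneg [of "Idle (m + 1)"] unfolding idle_def by linarith
qed

definition L :: real where "L = load / idle"

lemma odds_le_L: "odds \<delta> m \<le> L"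
proof -
  have "idle * odds \<delta> m \<le> load"
    unfolding load_eq idle_def distrib_right
    using odds_less_Suc [OF delta_pos, of m]
    by (intro add_left_mono mult_left_mono p_nonneg) auto
  then show ?thesis
    using idle_pos by (simp add: L_def field_simps)
qed

lemma Idle_m_eq: "p (Idle m) = idle * idle_frac m \<nu> L"
proof -
  have nd: "0 < \<nu> + \<delta>"
    using nu_nonneg delta_pos by simp
  have "(\<nu> + \<delta>) * p (Idle m) = \<delta> * (idle * idle_factor m \<nu> L)"
  proof (cases "m = 0")
    case True
    then show ?thesis
      using idle_balance_0 unfolding idle_factor_def idle_def by (simp add: algebra_simps)
  next
    case False
    have "idle * ((L - \<delta>) * transit \<nu> + y \<nu>) = load * transit \<nu> + idle * (y \<nu> - \<delta> * transit \<nu>)"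
      using idle_pos by (simp add: L_def algebra_simps)
    then show ?thesis
      using False full_idle_balance
      by (simp add: idle_factor_def transit_def u_def mult.left_commute mult.assoc)
  qed
  then show ?thesis
    using nd by (simp add: idle_frac_def field_simps)
qed

text \<open>Obtained from the balance equations alone, for every stationary p; uniqueness of the
  stationary distribution rests on it.\<close>

lemma Idle_m_pos: "0 < p (Idle m)"
  using idle_pos idle_frac_pos [OF nu_nonneg odds_le_L] by (simp add: Idle_m_eq)

text \<open>Replacing p(0, m + 1) by idle - p(0, m) in \<open>load_eq\<close> leaves an equation
  between L and \<nu> only.\<close>

lemma L_fixpoint: "L = odds \<delta> (Suc m) - \<delta> / y \<delta> ^ m * idle_frac m \<nu> L"
proof -
  have "load = idle * odds \<delta> (Suc m) - \<delta> / y \<delta> ^ m * p (Idle m)"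
    by (simp add: load_eq idle_def odds_Suc algebra_simps add_divide_distrib)
  then have "load = idle * (odds \<delta> (Suc m) - \<delta> / y \<delta> ^ m * idle_frac m \<nu> L)"
    unfolding Idle_m_eq by (simp add: algebra_simps)
  \<comment> \<open>The name X shields the L on the right side while \<open>L_def\<close> is
    unfolded on the left.\<close>
  moreover define X where "X = odds \<delta> (Suc m) - \<delta> / y \<delta> ^ m * idle_frac m \<nu> L"
  ultimately have "load = idle * X"
    by simp
  then have "L = X"
    using idle_pos by (simp add: L_def)
  then show ?thesis
    by (simp only: X_def)
qed

lemma L_less_odds: "L < odds \<delta> (Suc m)"
proof -
  have "0 < \<delta> / y \<delta> ^ m * idle_frac m \<nu> L"
    using idle_frac_pos [OF nu_nonneg odds_le_L] delta_pos y_pos [of \<delta>] by simp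
  then show ?thesis
    using L_fixpoint by linarith
qed

end

section \<open>The queue at the cavity\<close>

context push_policy
begin

lemma stationary_pushI: "0 \<le> \<nu> \<Longrightarrow> is_stationary \<alpha> S \<delta> m \<nu> p \<Longrightarrow> stationary_push \<alpha> S \<delta> m \<nu> p"
  by unfold_locales

lemma null_vector_imp_stationary:
  assumes "\<And>x. x \<in> states m \<Longrightarrow> 0 \<le> p x" "x0 \<in> states m" "p x0 \<noteq> 0"
    and "\<And>z. z \<in> states m \<Longrightarrow> (\<Sum>x\<in>states m. p x * generator \<alpha> S \<delta> m \<nu> x z) = 0"
  shows "is_stationary \<alpha> S \<delta> m \<nu>
    (\<lambda>x. if x \<in> states m then p x / (\<Sum>x\<in>states m. p x) else 0)"
proof -
  have "0 < (\<Sum>x\<in>states m. p x)"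
    using assms(1,2,3) by (intro sum_pos2 [OF finite_states, of x0]) (auto simp: less_le)
  then show ?thesis
    using assms(1,4)
    by (auto simp: is_stationary_def simp flip: sum_divide_distrib)
qed

lemma ex_stationary:
  assumes "0 \<le> \<nu>"
  shows "\<exists>p. is_stationary \<alpha> S \<delta> m \<nu> p"
proof -
  have "states m \<noteq> ({} :: 'n state set)"
    by (auto simp: states_def)
  then have "\<exists>p. (\<forall>x\<in>states m. 0 \<le> p x) \<and> (\<exists>x\<in>states m. p x \<noteq> 0)
      \<and> (\<forall>z\<in>states m. (\<Sum>x\<in>states m. p x * generator \<alpha> S \<delta> m \<nu> x z) = 0)"
    by (rule generator_null_vector [OF finite_states])
      (simp_all add: generator_off_diag_nonneg [OF assms] generator_row_sum)
  then obtain p x0 where "\<forall>x\<in>states m. 0 \<le> p x" "x0 \<in> states m" "p x0 \<noteq> 0"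
    "\<forall>z\<in>states m. (\<Sum>x\<in>states m. p x * generator \<alpha> S \<delta> m \<nu> x z) = 0"
    by blast
  then have "is_stationary \<alpha> S \<delta> m \<nu> (\<lambda>x. if x \<in> states m then p x / (\<Sum>x\<in>states m. p x) else 0)"
    by (intro null_vector_imp_stationary) simp_all
  then show ?thesis
    by (intro exI)
qed

text \<open>Subtracting a multiple of \<open>p'\<close> from \<open>p\<close> gives a null vector that vanishes at \<open>Idle m\<close>. If it
  were nonzero, then normalising its absolute value would give a stationary distribution without
  mass at \<open>Idle m\<close>.\<close>

lemma stationary_unique:
  assumes "0 \<le> \<nu>" and p: "is_stationary \<alpha> S \<delta> m \<nu> p" and p': "is_stationary \<alpha> S \<delta> m \<nu> p'"
  shows "p = p'"
proof -
  interpret P: stationary_push \<alpha> S \<delta> m \<nu> p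
    by (rule stationary_pushI) fact+
  interpret P': stationary_push \<alpha> S \<delta> m \<nu> p'
    by (rule stationary_pushI) fact+
  define c where "c = p (Idle m) / p' (Idle m)"
  define d where "d x = p x - c * p' x" for x
  have d0: "d (Idle m) = 0"
    using P'.Idle_m_pos by (simp add: d_def c_def)
  have "(\<Sum>x\<in>states m. d x * generator \<alpha> S \<delta> m \<nu> x z) = 0" if "z \<in> states m" for z
    using P.p_null [OF that] P'.p_null [OF that]
    by (simp add: d_def left_diff_distrib sum_subtractf mult.assoc flip: sum_distrib_left)
  then have null: "(\<Sum>x\<in>states m. \<bar>d x\<bar> * generator \<alpha> S \<delta> m \<nu> x z) = 0" if "z \<in> states m" for z
    using that generator_off_diag_nonneg [OF \<open>0 \<le> \<nu>\<close>] generator_row_sum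
    by (intro generator_null_vector_abs [OF finite_states]) auto
  have "d x = 0" if x: "x \<in> states m" for x
  proof (rule ccontr)
    assume "d x \<noteq> 0"
    then have "is_stationary \<alpha> S \<delta> m \<nu>
        (\<lambda>x. if x \<in> states m then \<bar>d x\<bar> / (\<Sum>x\<in>states m. \<bar>d x\<bar>) else 0)"
      using null x by (intro null_vector_imp_stationary [of m _ x]) auto
    then interpret D: stationary_push \<alpha> S \<delta> m \<nu>
      "\<lambda>x. if x \<in> states m then \<bar>d x\<bar> / (\<Sum>x\<in>states m. \<bar>d x\<bar>) else 0"
      using \<open>0 \<le> \<nu>\<close> by (intro stationary_pushI)
    show False
      using D.Idle_m_pos by (simp add: d0)
  qed
  then have eq: "p x = c * p' x" if "x \<in> states m" for x
    using that by (simp add: d_def)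
  then have "(\<Sum>x\<in>states m. p x) = c * (\<Sum>x\<in>states m. p' x)"
    by (simp add: sum_distrib_left)
  then have "c = 1"
    by (simp add: P.p_sum P'.p_sum)
  show "p = p'"
  proof
    fix x
    show "p x = p' x"
      using eq [of x] \<open>c = 1\<close> p p' by (cases "x \<in> states m") (auto simp: is_stationary_def)
  qed
qed

lemma is_stationary_stationary:
  assumes "0 \<le> \<nu>"
  shows "is_stationary \<alpha> S \<delta> m \<nu> (stationary \<alpha> S \<delta> m \<nu>)"
proof -
  obtain p where "is_stationary \<alpha> S \<delta> m \<nu> p"
    using ex_stationary [OF assms] by blast
  then show ?thesis
    unfolding stationary_def
  proof (rule theI [where P = "is_stationary \<alpha> S \<delta> m \<nu>"])
    show "p' = p" if "is_stationary \<alpha> S \<delta> m \<nu> p'" for p'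
      using assms that \<open>is_stationary \<alpha> S \<delta> m \<nu> p\<close> by (rule stationary_unique)
  qed
qed

lemma stationary_push_stationary:
  "0 \<le> \<nu> \<Longrightarrow> stationary_push \<alpha> S \<delta> m \<nu> (stationary \<alpha> S \<delta> m \<nu>)"
  by (intro stationary_pushI is_stationary_stationary)

lemma queue_prob_pos_iff:
  assumes "0 \<le> \<nu>"
  shows "0 < queue_prob \<alpha> S \<delta> m \<nu> q \<longleftrightarrow>
    (\<exists>x\<in>states m. queue_length x = q \<and> stationary \<alpha> S \<delta> m \<nu> x \<noteq> 0)"
proof -
  interpret stationary_push \<alpha> S \<delta> m \<nu> "stationary \<alpha> S \<delta> m \<nu>"
    using assms by (rule stationary_push_stationary)
  have "finite {x \<in> states m :: 'n state set. queue_length x = q}"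
    by (simp add: finite_states)
  then have "0 \<le> queue_prob \<alpha> S \<delta> m \<nu> q"
    and "queue_prob \<alpha> S \<delta> m \<nu> q = 0 \<longleftrightarrow>
      (\<forall>x\<in>{x \<in> states m. queue_length x = q}. stationary \<alpha> S \<delta> m \<nu> x = 0)"
    by (auto simp: queue_prob_def p_nonneg sum_nonneg sum_nonneg_eq_0_iff)
  then show ?thesis
    by (auto simp: less_le)
qed

lemma queue_prob_0:
  "queue_prob \<alpha> S \<delta> m \<nu> 0 = stationary \<alpha> S \<delta> m \<nu> (Idle m) + stationary \<alpha> S \<delta> m \<nu> (Idle (m + 1))"
proof -
  have "{x \<in> states m :: 'n state set. queue_length x = 0} = {Idle m, Idle (m + 1)}"
    by (auto simp: states_def)
  then show ?thesis
    by (simp add: queue_prob_def)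
qed

end

section \<open>Mass at the longest possible queues\<close>

context stationary_push
begin

text \<open>The states (m + 1, m + 1, j) are entered from other queue lengths only by an assignment
  in (m, m, j), and their queue length drops only by a service completion.\<close>

lemma pvec_top:
  assumes "1 \<le> m"
  shows "- (pvec (m + 1) (m + 1) \<bullet> (S *v k)) = \<nu> * (pvec m m \<bullet> k)"
  using full_balance [OF assms, of 0 k] by simp

text \<open>Otherwise nothing would flow towards \<open>Idle m\<close>, which carries mass.\<close>

lemma pvec_m_nonzero:
  assumes "1 \<le> m"
  shows "pvec m m \<noteq> 0"
  using pvec_m_inner_exit [OF assms] Idle_m_pos nu_nonneg delta_pos by auto

lemma pvec_top_nonzero:
  assumes "0 < \<nu>"
  shows "pvec (m + 1) (m + 1) \<noteq> 0"
proof
  assume 0: "pvec (m + 1) (m + 1) = 0"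
  show False
  proof (cases "m = 0")
    case True
    then show False
      using pvec_balance_0 Idle_m_pos 0 assms by auto
  next
    case False
    then have "pvec m m \<bullet> 1 = 0"
      using pvec_top [of 1] 0 assms by simp
    then have "pvec m m = 0"
      using p_nonneg by (simp add: inner_vec_def vec_eq_iff sum_nonneg_eq_0_iff)
    with pvec_m_nonzero False show False
      by simp
  qed
qed

lemma pvec_top_zero:
  assumes "1 \<le> m" "\<nu> = 0"
  shows "pvec (m + 1) (m + 1) = 0"
proof -
  have "pvec (m + 1) (m + 1) \<bullet> 1 = 0"
    \<comment> \<open>Here S k = -1, so the left side of \<open>pvec_top\<close> is the total mass
      of the top level.\<close>
    using pvec_top [OF assms(1), of "resolvent 0 1"] assms by (simp add: S_mult_resolvent)
  then show ?thesis
    using p_nonneg by (simp add: inner_vec_def vec_eq_iff sum_nonneg_eq_0_iff)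
qed

end

section \<open>The cavity pair and its longest queue\<close>

context push_policy
begin

lemma Max_queue_prob:
  assumes "0 \<le> \<nu>" "0 < \<nu> \<or> 1 \<le> m"
  shows "Max {q. 0 < queue_prob \<alpha> S \<delta> m \<nu> q} = (if \<nu> = 0 then m else m + 1)"
proof -
  interpret stationary_push \<alpha> S \<delta> m \<nu> "stationary \<alpha> S \<delta> m \<nu>"
    using assms(1) by (rule stationary_push_stationary)
  note pos_iff = queue_prob_pos_iff [OF assms(1)]
  have bound: "q \<le> m + 1" if pos: "0 < queue_prob \<alpha> S \<delta> m \<nu> q" for q
  proof -
    obtain x :: "'n state" where "x \<in> states m" "queue_length x = q"
      using pos unfolding pos_iff by blast
    then show ?thesis
      by (cases x) auto
  qed
  have "{q. 0 < queue_prob \<alpha> S \<delta> m \<nu> q} \<subseteq> {..m + 1}"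
    using bound by auto
  then have "finite {q. 0 < queue_prob \<alpha> S \<delta> m \<nu> q}"
    by (rule finite_subset) simp
  moreover have "q \<le> (if \<nu> = 0 then m else m + 1)" if q: "0 < queue_prob \<alpha> S \<delta> m \<nu> q" for q
  proof (cases "\<nu> = 0")
    case True
    have "q \<noteq> m + 1"
    proof
      assume "q = m + 1"
      then obtain x where x: "x \<in> states m" "queue_length x = m + 1" "stationary \<alpha> S \<delta> m \<nu> x \<noteq> 0"
        using q unfolding pos_iff by blast
      then obtain j where j: "x = Busy (m + 1) (m + 1) j"
        by (cases x) auto
      have "pvec (m + 1) (m + 1) = 0"
        using pvec_top_zero assms True by simp
      then have "pvec (m + 1) (m + 1) $ j = 0"
        by (simp only: zero_index)
      with x(3) j show False
        by (simp only: pvec_nth)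
    qed
    with bound [OF q] True show ?thesis
      by simp
  qed (use bound [OF q] in simp)
  moreover have "0 < queue_prob \<alpha> S \<delta> m \<nu> (if \<nu> = 0 then m else m + 1)"
  proof (cases "\<nu> = 0")
    case True
    then have "pvec m m \<noteq> 0"
      using pvec_m_nonzero assms by simp
    then obtain j where "stationary \<alpha> S \<delta> m \<nu> (Busy m m j) \<noteq> 0"
      by (auto simp: vec_eq_iff)
    then show ?thesis
      using True assms unfolding pos_iff by (intro bexI [of _ "Busy m m j"]) auto
  next
    case False
    then have "pvec (m + 1) (m + 1) \<noteq> 0"
      using pvec_top_nonzero assms by simp
    then obtain j where "stationary \<alpha> S \<delta> m \<nu> (Busy (m + 1) (m + 1) j) \<noteq> 0"
      by (auto simp: vec_eq_iff)
    then show ?thesis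
      using False unfolding pos_iff by (intro bexI [of _ "Busy (m + 1) (m + 1) j"]) auto
  qed
  ultimately show ?thesis
    by (intro Max_eqI) auto
qed

text \<open>The condition on the left says that the chain's own ratio \<open>P.L\<close> equals L.
  Conversely, if L satisfies the fixed point equation, it solves the same equation as
  \<open>P.L\<close>; the right side is nonincreasing in the unknown, so the two solutions
  agree.\<close>

lemma queue_prob_0_iff:
  assumes "0 \<le> \<nu>" "0 \<le> lam" "lam < 1"
  defines "L \<equiv> lam / (1 - lam)"
  shows "queue_prob \<alpha> S \<delta> m \<nu> 0 = 1 - lam \<longleftrightarrow> odds \<delta> m \<le> L \<and> L < odds \<delta> (Suc m) \<and>
    L = odds \<delta> (Suc m) - \<delta> / y \<delta> ^ m * idle_frac m \<nu> L"
proof -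
  interpret P: stationary_push \<alpha> S \<delta> m \<nu> "stationary \<alpha> S \<delta> m \<nu>"
    using assms(1) by (rule stationary_push_stationary)
  have idle: "queue_prob \<alpha> S \<delta> m \<nu> 0 = P.idle"
    by (simp add: queue_prob_0 P.idle_def)
  have idle_L: "P.idle = 1 - lam \<longleftrightarrow> P.L = L"
    using P.idle_pos assms by (auto simp: P.L_def P.load_def L_def field_simps)
  have "P.L = L" if "odds \<delta> m \<le> L" "L = odds \<delta> (Suc m) - \<delta> / y \<delta> ^ m * idle_frac m \<nu> L"
  proof -
    have less: False if "L1 < L2"
      "L1 = odds \<delta> (Suc m) - \<delta> / y \<delta> ^ m * idle_frac m \<nu> L1"
      "L2 = odds \<delta> (Suc m) - \<delta> / y \<delta> ^ m * idle_frac m \<nu> L2" for L1 L2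
    proof -
      have "\<delta> / y \<delta> ^ m * idle_frac m \<nu> L1 \<le> \<delta> / y \<delta> ^ m * idle_frac m \<nu> L2"
        using that(1) assms(1) delta_pos y_pos [of \<delta>]
        by (intro mult_left_mono idle_frac_mono_odds) auto
      then show False
        using that by linarith
    qed
    show ?thesis
      using less [of L P.L] less [of P.L L] P.L_fixpoint that(2)
      by (cases L P.L rule: linorder_cases) auto
  qed
  then show ?thesis
    using P.odds_le_L P.L_less_odds P.L_fixpoint unfolding idle idle_L by (intro iffI) simp_all
qed

text \<open>The intervals from \<open>odds \<delta> m\<close> to
  \<open>odds \<delta> (Suc m)\<close> are disjoint, so L determines m. The fixed point equation
  then prescribes the value of \<open>idle_frac\<close> at \<nu>, a number in (0, 1] that is
  attained exactly once.\<close>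

lemma cavity_pair_eq:
  assumes lam: "0 \<le> lam" "lam < 1"
    and L: "odds \<delta> m \<le> lam / (1 - lam)" "lam / (1 - lam) < odds \<delta> (Suc m)"
  obtains \<nu> where "0 \<le> \<nu>" "cavity_pair \<alpha> S \<delta> lam = (m, \<nu>)"
    "\<nu> = 0 \<longleftrightarrow> lam / (1 - lam) = odds \<delta> m"
proof -
  define L where "L = lam / (1 - lam)"
  note iff = queue_prob_0_iff [OF _ lam, folded L_def]
  define c where "c = \<delta> / y \<delta> ^ m"
  have "0 < c"
    using delta_pos y_pos [of \<delta>] by (simp add: c_def)
  have odds_Suc_m: "odds \<delta> (Suc m) = odds \<delta> m + c"
    by (simp add: odds_Suc c_def)
  have fixpoint: "L = odds \<delta> (Suc m) - c * f \<longleftrightarrow> f = (odds \<delta> (Suc m) - L) / c" for f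
    using \<open>0 < c\<close> by (auto simp: field_simps)
  have "0 < (odds \<delta> (Suc m) - L) / c" "(odds \<delta> (Suc m) - L) / c \<le> 1"
    using L \<open>0 < c\<close> by (simp_all add: L_def odds_Suc_m)
  then obtain \<nu> where \<nu>: "0 \<le> \<nu>" "idle_frac m \<nu> L = (odds \<delta> (Suc m) - L) / c"
    using idle_frac_surj L(1) unfolding L_def by blast
  have inj: "\<mu> = \<nu>" if "0 \<le> \<mu>" "idle_frac m \<mu> L = (odds \<delta> (Suc m) - L) / c" for \<mu>
    using idle_frac_strict_antimono [of \<mu> \<nu> m L] idle_frac_strict_antimono [of \<nu> \<mu> m L] that \<nu> L(1)
    by (cases \<mu> \<nu> rule: linorder_cases) (auto simp: L_def)
  have "cavity_pair \<alpha> S \<delta> lam = (m, \<nu>)"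
    unfolding cavity_pair_def
  proof (rule the_equality)
    have "L = odds \<delta> (Suc m) - c * idle_frac m \<nu> L"
      by (simp only: fixpoint \<nu>(2))
    moreover have "odds \<delta> m \<le> L" "L < odds \<delta> (Suc m)"
      using L by (simp_all only: L_def)
    ultimately show "case (m, \<nu>) of (m, \<nu>) \<Rightarrow> \<nu> \<ge> 0 \<and> queue_prob \<alpha> S \<delta> m \<nu> 0 = 1 - lam"
      unfolding prod.case iff [OF \<nu>(1)] using \<nu>(1) by (simp only: c_def simp_thms)
  next
    fix a
    assume "case a of (m, \<nu>) \<Rightarrow> \<nu> \<ge> 0 \<and> queue_prob \<alpha> S \<delta> m \<nu> 0 = 1 - lam"
    then obtain m' \<nu>' where a: "a = (m', \<nu>')" "0 \<le> \<nu>'" "queue_prob \<alpha> S \<delta> m' \<nu>' 0 = 1 - lam"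
      by (cases a) auto
    then have L': "odds \<delta> m' \<le> L" "L < odds \<delta> (Suc m')"
      "L = odds \<delta> (Suc m') - \<delta> / y \<delta> ^ m' * idle_frac m' \<nu>' L"
      using iff [of \<nu>' m'] by blast+
    have "m' = m"
      using L L' odds_mono [OF delta_pos, of "Suc m" m'] odds_mono [OF delta_pos, of "Suc m'" m]
      by (cases m m' rule: linorder_cases) (auto simp: L_def Suc_le_eq)
    with L'(3) inj a show "a = (m, \<nu>)"
      by (simp add: fixpoint flip: c_def)
  qed
  moreover have "\<nu> = 0 \<longleftrightarrow> L = odds \<delta> m"
  proof
    assume "L = odds \<delta> m"
    then show "\<nu> = 0"
      using inj [of 0] \<open>0 < c\<close> by (simp add: idle_frac_0 odds_Suc_m)
  next
    assume "\<nu> = 0"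
    \<comment> \<open>At \<nu> = 0 \<open>idle_frac\<close> is at least 1, while the prescribed
      value is at most 1, with equality only for L = \<open>odds \<delta> m\<close>.\<close>
    then have "1 \<le> (odds \<delta> (Suc m) - L) / c"
      using \<nu>(2) idle_frac_mono_odds [of 0 "odds \<delta> m" L m] L(1) by (simp add: idle_frac_0 L_def)
    then show "L = odds \<delta> m"
      using L(1) \<open>0 < c\<close> by (simp add: L_def odds_Suc_m)
  qed
  ultimately show thesis
    using that \<nu>(1) by (simp add: L_def)
qed

text \<open>The intervals are closed at the other end here. The right endpoint belongs to the pair
  (m, 0), whose longest queue is m; the other points belong to pairs (m - 1, \<nu>) with \<nu> > 0,
  whose longest queue is (m - 1) + 1.\<close>

lemma max_queue_length_eq:
  assumes "0 < m" "lam < 1"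
    and L: "odds \<delta> (m - 1) < lam / (1 - lam)" "lam / (1 - lam) \<le> odds \<delta> m"
  shows "max_queue_length \<alpha> S \<delta> lam = m"
proof -
  have "0 < lam / (1 - lam)"
    using L(1) odds_nonneg [OF delta_pos, of "m - 1"] by linarith
  then have "0 \<le> lam"
    using assms(2) by (simp add: zero_less_divide_iff)
  show ?thesis
  proof (cases "lam / (1 - lam) = odds \<delta> m")
    case True
    then obtain \<nu> where "0 \<le> \<nu>" "cavity_pair \<alpha> S \<delta> lam = (m, \<nu>)" "\<nu> = 0"
      using cavity_pair_eq [OF \<open>0 \<le> lam\<close> assms(2), of m] odds_less_Suc [OF delta_pos, of m] by auto
    then show ?thesis
      using Max_queue_prob [of 0 m] assms(1) by (simp add: max_queue_length_def)
  next
    case False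
    then obtain \<nu> where "0 \<le> \<nu>" "cavity_pair \<alpha> S \<delta> lam = (m - 1, \<nu>)" "\<nu> \<noteq> 0"
      using cavity_pair_eq [OF \<open>0 \<le> lam\<close> assms(2), of "m - 1"] L assms(1) by auto
    then show ?thesis
      using Max_queue_prob [of \<nu> "m - 1"] assms(1) by (simp add: max_queue_length_def)
  qed
qed

end

theorem corollary4p5:
  fixes \<alpha> :: "real^'n" and S :: "real^'n^'n"
  assumes "phase_type \<alpha> S" and "ph_mean \<alpha> S = 1"
  shows "(\<forall>\<delta>::real. \<delta> > 0 \<longrightarrow>
            (\<forall>m::nat. m > 0 \<longrightarrow>
              (\<forall>lam\<in>{lambda_thr \<alpha> S \<delta> (m - 1)<..lambda_thr \<alpha> S \<delta> m}.
                 max_queue_length \<alpha> S \<delta> lam = m)))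
       \<and> (\<forall>lam::real. 0 < lam \<and> lam < 1 \<longrightarrow>
            (\<forall>m::nat. m \<ge> 1 \<longrightarrow> (\<exists>!d. is_delta_thr \<alpha> S lam m d)) \<and>
            (\<forall>m::nat. m > 0 \<longrightarrow>
              (\<forall>\<delta>::real. delta_thr \<alpha> S lam m \<le> ereal \<delta> \<and> ereal \<delta> < delta_thr \<alpha> S lam (m - 1) \<longrightarrow>
                 max_queue_length \<alpha> S \<delta> lam = m)))"
proof (intro conjI allI impI ballI)
  interpret phase_type_dist \<alpha> S
    using assms by unfold_locales
  {
    fix \<delta> lam :: real and m :: nat
    assume \<delta>: "0 < \<delta>" and m: "0 < m"
      and lam: "lam \<in> {lambda_thr \<alpha> S \<delta> (m - 1)<..lambda_thr \<alpha> S \<delta> m}"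
    interpret push_policy \<alpha> S \<delta>
      using \<delta> by unfold_locales
    have nn: "0 \<le> odds \<delta> k" for k
      using \<delta> by (rule odds_nonneg)
    have lower: "odds \<delta> (m - 1) / (1 + odds \<delta> (m - 1)) < lam"
      and upper: "lam \<le> odds \<delta> m / (1 + odds \<delta> m)"
      using lam by (simp_all add: lambda_thr_eq \<delta>)
    \<comment> \<open>The thresholds lie below 1, so lam < 1 and the bounds on lam can be passed to
      lam / (1 - lam).\<close>
    have "odds \<delta> m / (1 + odds \<delta> m) < 1"
      using nn [of m] by simp
    with upper have "lam < 1"
      by linarith
    moreover have "odds \<delta> (m - 1) < lam / (1 - lam)"
      using lower nn [of "m - 1"] \<open>lam < 1\<close> by (simp add: field_simps)
    moreover have "lam / (1 - lam) \<le> odds \<delta> m"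
      using upper nn [of m] \<open>lam < 1\<close> by (simp add: field_simps)
    ultimately show "max_queue_length \<alpha> S \<delta> lam = m"
      using m by (intro max_queue_length_eq)
  }
  fix lam :: real
  assume lam: "0 < lam \<and> lam < 1"
  then have "0 < lam / (1 - lam)"
    by simp
  then have ex1: "\<exists>!d. is_delta_thr \<alpha> S lam m d" if "1 \<le> m" for m
    using odds_eq_ex1 [of "lam / (1 - lam)" m] that by (simp add: is_delta_thr_iff)
  then show "\<exists>!d. is_delta_thr \<alpha> S lam m d" if "1 \<le> m" for m
    using that .
  fix m :: nat and \<delta> :: real
  assume m: "0 < m"
    and \<delta>: "delta_thr \<alpha> S lam m \<le> ereal \<delta> \<and> ereal \<delta> < delta_thr \<alpha> S lam (m - 1)"
  \<comment> \<open>Unique existence makes the description in \<open>delta_thr\<close> a genuine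
    solution.\<close>
  have thr: "\<exists>d. delta_thr \<alpha> S lam k = ereal d \<and> 0 < d \<and> odds d k = lam / (1 - lam)"
    if "1 \<le> k" for k
  proof -
    have "is_delta_thr \<alpha> S lam k (THE d. is_delta_thr \<alpha> S lam k d)"
      by (rule theI' [OF ex1 [OF that]])
    then show ?thesis
      unfolding is_delta_thr_iff [OF that] delta_thr_def using that
      by (intro exI [of _ "THE d. is_delta_thr \<alpha> S lam k d"]) (simp add: is_delta_thr_iff)
  qed
  obtain d where d: "delta_thr \<alpha> S lam m = ereal d" "0 < d" "odds d m = lam / (1 - lam)"
    using thr [of m] m by auto
  then have "d \<le> \<delta>" "0 < \<delta>"
    using \<delta> by auto
  interpret push_policy \<alpha> S \<delta>
    using \<open>0 < \<delta>\<close> by unfold_locales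
  have "odds \<delta> (m - 1) < lam / (1 - lam)"
  \<comment> \<open>For m > 1 the bound follows from \<delta> < delta_{m-1} by monotonicity. For m =
    1 the upper limit is infinite, and \<open>odds \<delta> 0\<close> = 0 lies below lam / (1 -
    lam).\<close>
  proof (cases "m = 1")
    case False
    with m have "1 \<le> m - 1"
      by linarith
    then obtain d' where "delta_thr \<alpha> S lam (m - 1) = ereal d'" "odds d' (m - 1) = lam / (1 - lam)"
      using thr [of "m - 1"] by blast
    then show ?thesis
      using odds_strict_mono [of \<delta> d' "m - 1"] \<delta> \<open>0 < \<delta>\<close> m False by auto
  qed (use \<open>0 < lam / (1 - lam)\<close> in simp)
  moreover have "lam / (1 - lam) \<le> odds \<delta> m"
    using odds_strict_mono [of d \<delta> m] d \<open>d \<le> \<delta>\<close> m by (cases "d = \<delta>") auto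
  ultimately show "max_queue_length \<alpha> S \<delta> lam = m"
    using m lam by (intro max_queue_length_eq) auto
qed

end
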